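(* Let $V\in\hat{\mathcal{V}}^{4}_{\delta_4}$ for some integer $1/\delta_4\in[4,+\infty)$, and let $w:\mathbb{R}^d\to[0,\infty)$ be continuous with $$\mathcal{L}V(x)\le -w(x)\qquad\forall x\in\mathbb{R}^d .$$ Assume that $V(\epsilon x)\le V(x)$ for all $x\in\mathbb{R}^d$, $0<\epsilon\le1$, and that $$\sup_{0<|x|\le u}\frac{(1+V(x))^{1-2\delta_4}\big(|f(x)|^2\vee|g(x)|^2\big)}{\Lambda_1(x)V(x)}<+\infty\qquad\forall u>0,\qquad \Lambda_1(x):=1\wedge\frac{w(x)}{V(x)} .$$ Then there is a constant $\Delta^{**}\in(0,\Delta^*]$ such that for any $\Delta\in(0,\Delta^{**}]$ the truncated Euler--Maruyama scheme $\{Z_k\}$ defined in the context satisfies $$\limsup_{k\to\infty}V(Z_k)<\infty,\qquad\lim_{k\to\infty}d\big(Z_k,\mathrm{Ker}(w)\big)=0\qquad\text{a.s.}$$ Moreover, if $w(x)=0$ if and only if $x=\mathbf{0}\in\mathbb{R}^d$, then for any $\Delta\in(0,\Delta^{**}]$, $\lim_{k\to\infty}Z_k=\mathbf{0}$ a.s.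
   Context: **SDE.** $|\cdot|$ is the Euclidean norm on $\mathbb{R}^d$ and the trace (Frobenius) norm on matrices; $\bar{\mathbb{R}}_+=[0,\infty)$; $a\vee b=\max\{a,b\}$, $a\wedge b=\min\{a,b\}$. On a complete filtered probability space $(\Omega,\mathcal{F},\{\mathcal{F}_t\}_{t\ge0},\mathbb{P})$ satisfying the usual conditions, $B(t)$ is an $m$-dimensional $\mathcal{F}_t$-Brownian motion. Consider $\mathrm{d}X(t)=f(X(t))\mathrm{d}t+g(X(t))\mathrm{d}B(t)$, $X(0)=x_0\in\mathbb{R}^d$, where $f:\mathbb{R}^d\to\mathbb{R}^d$, $g:\mathbb{R}^d\to\mathbb{R}^{d\times m}$ are locally Lipschitz continuous with $f(\mathbf{0})=\mathbf{0}$ and $g(\mathbf{0})=\mathbf{0}$. **Lyapunov functions.** $\mathcal{C}^p_\infty(\mathbb{R}^d;\bar{\mathbb{R}}_+)$ is the set of nonnegative $p$-times continuously differentiable functions on $\mathbb{R}^d$ tending to $\infty$ as $|x|\to\infty$. For a multiindex $\alpha$, $D^\alpha V$ is the usual partial derivative; $|D^{(n)}V(x)|=\big(\sum_{|\alpha|=n}|D^\alpha V(x)|^2\big)^{1/2}$; $D^{(1)}V$ is the gradient (row vector), $D^{(2)}V$ the Hessian (Frobenius norm). $\mathrm{Ker}(h)=\{x\in\mathbb{R}^d:h(x)=0\}$, and $d(x,A)$ is the distance from $x$ to the set $A$. For integers $p\ge2$ and $1/\delta_p\ge p$, $$\hat{\mathcal{V}}^{p}_{\delta_p}=\{V\in\mathcal{C}^p_\infty(\mathbb{R}^d;\bar{\mathbb{R}}_+):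 \mathrm{Ker}(V)=\{\mathbf{0}\},\ \exists c>0,\ |D^{(n)}V|\le c(1+V)^{1-n\delta_p},\ n=1,\dots,p\}.$$ $\mathcal{L}V(x)=\langle D^{(1)}V(x),f(x)\rangle+\frac12\mathrm{tr}[g^T(x)D^{(2)}V(x)g(x)]$. In quotients with denominator containing $\Lambda_1(x)=0$, $0/0$ is read as $0$ and $a/0$ as $+\infty$ for $a>0$. **Scheme.** Choose a strictly increasing continuous $\hat\varphi:\bar{\mathbb{R}}_+\to\bar{\mathbb{R}}_+$ with $\hat\varphi(u)\to\infty$ as $u\to\infty$ and $$\sup_{0<|x|\le u}\left\{\frac{(1+V(x))^{\frac12-\delta_4}|f(x)|}{(\Lambda_1(x)V(x))^{1/2}}\vee\frac{(1+V(x))^{1-2\delta_4}|g(x)|^2}{\Lambda_1(x)V(x)}\right\}\le\hat\varphi(u)\qquad\forall u\ge1,$$ with inverse $\hat\varphi^{-1}:[\hat\varphi(1),\infty)\to\bar{\mathbb{R}}_+$. Choose $0<\hat\theta<1/2$ and constants $\Delta^*\in(0,1)$, $K>0$ with $K(\Delta^* )^{-\hat\theta}\ge\hat\varphi(|x_0|\vee1)$ ($K$ independent of $k$ and $\Delta$). For $\Delta\in(0,\Delta^*]$ put $\hat\pi_\Delta(x)=\big(|x|\wedge\hat\varphi^{-1}(K\Delta^{-\hat\theta})\big)\frac{x}{|x|}$ (with $x/|x|=\mathbf{0}$ for $x=\mathbf{0}$), $t_k=k\Delta$, $\Delta B_k=B(t_{k+1})-B(t_k)$, and for integers $k\ge0$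 $$Z_0=x_0,\quad\tilde Z_{k+1}=Z_k+f(Z_k)\Delta+g(Z_k)\Delta B_k,\quad Z_{k+1}=\hat\pi_\Delta(\tilde Z_{k+1}).$$ *)

theory Defs
  imports "HOL-Probability.Probability"
begin

section \<open>Partial derivatives and Lyapunov functions\<close>

definition partial_deriv :: "'d::finite \<Rightarrow> (real^'d \<Rightarrow> real) \<Rightarrow> real^'d \<Rightarrow> real" where
  "partial_deriv i V x = deriv (\<lambda>t. V (x + t *\<^sub>R axis i 1)) 0"

text \<open>An enumeration of the coordinates without repetition. The index type carries no order, so
  one is fixed here; for \<open>\<bar>\<alpha>\<bar>\<close>-times continuously differentiable functions the mixed partial
  derivative below does not depend on it (Schwarz).\<close>

definition coords :: "'d::finite list" where
  "coords = (SOME xs. distinct xs \<and> set xs = UNIV)"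

text \<open>\<open>D\<^sup>\<alpha> V\<close>, with a multiindex represented as a function from coordinates to \<open>nat\<close>.\<close>

definition multi_deriv :: "('d::finite \<Rightarrow> nat) \<Rightarrow> (real^'d \<Rightarrow> real) \<Rightarrow> real^'d \<Rightarrow> real" where
  "multi_deriv \<alpha> V = foldr (\<lambda>i. partial_deriv i ^^ \<alpha> i) coords V"

definition deriv_norm :: "nat \<Rightarrow> (real^'d::finite \<Rightarrow> real) \<Rightarrow> real^'d \<Rightarrow> real" where
  "deriv_norm n V x = sqrt (\<Sum>\<alpha> | (\<Sum>i\<in>UNIV. \<alpha> i) = n. (multi_deriv \<alpha> V x)\<^sup>2)"

lemma finite_multiindices: "finite {\<alpha> :: 'd::finite \<Rightarrow> nat. (\<Sum>i\<in>UNIV. \<alpha> i) = n}"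
proof (rule finite_subset)
  show "{\<alpha> :: 'd \<Rightarrow> nat. (\<Sum>i\<in>UNIV. \<alpha> i) = n} \<subseteq> PiE UNIV (\<lambda>_. {..n})"
    using member_le_sum[of _ "UNIV :: 'd set"] by fastforce
qed (auto intro: finite_PiE)

fun cont_diff :: "nat \<Rightarrow> (real^'d::finite \<Rightarrow> real) \<Rightarrow> bool" where
  "cont_diff 0 V \<longleftrightarrow> continuous_on UNIV V"
| "cont_diff (Suc n) V \<longleftrightarrow> V differentiable_on UNIV \<and> (\<forall>i. cont_diff n (partial_deriv i V))"

definition lyapunov_class :: "nat \<Rightarrow> real \<Rightarrow> (real^'d::finite \<Rightarrow> real) set" where
  "lyapunov_class p \<delta> = {V.
     cont_diff p V \<and> (\<forall>x. 0 \<le> V x) \<and> filterlim V at_top at_infinity \<and>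
     {x. V x = 0} = {0} \<and>
     (\<exists>c>0. \<forall>n\<in>{1..p}. \<forall>x. deriv_norm n V x \<le> c * (1 + V x) powr (1 - real n * \<delta>))}"

definition gradient :: "(real^'d::finite \<Rightarrow> real) \<Rightarrow> real^'d \<Rightarrow> real^'d" where
  "gradient V x = (\<chi> i. partial_deriv i V x)"

definition hessian :: "(real^'d::finite \<Rightarrow> real) \<Rightarrow> real^'d \<Rightarrow> real^'d^'d" where
  "hessian V x = (\<chi> i j. partial_deriv i (partial_deriv j V) x)"

definition generator ::
  "(real^'d::finite \<Rightarrow> real^'d) \<Rightarrow> (real^'d \<Rightarrow> real^'m::finite^'d) \<Rightarrow> (real^'d \<Rightarrow> real) \<Rightarrow> real^'d \<Rightarrow> real" where
  "generator f g V x =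
     gradient V x \<bullet> f x + 1/2 * trace (transpose (g x) ** hessian V x ** g x)"

definition Lambda1 :: "(real^'d::finite \<Rightarrow> real) \<Rightarrow> (real^'d \<Rightarrow> real) \<Rightarrow> real^'d \<Rightarrow> real" where
  "Lambda1 V w x = min 1 (w x / V x)"

section \<open>Brownian motion on a filtered probability space\<close>

text \<open>Only the times \<open>t \<ge> 0\<close> of the filtration and of the process matter, although both are indexed
  by \<open>real\<close>. The conditions on null sets say that the space is complete and that \<open>F 0\<close> contains
  all null sets.\<close>

definition usual_filtered_space :: "'w measure \<Rightarrow> (real \<Rightarrow> 'w measure) \<Rightarrow> bool" where
  "usual_filtered_space M F \<longleftrightarrow>
     prob_space M \<and> complete_measure M \<and>
     (\<forall>t\<ge>0. subalgebra M (F t)) \<and>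
     (\<forall>s t. 0 \<le> s \<and> s \<le> t \<longrightarrow> sets (F s) \<subseteq> sets (F t)) \<and>
     null_sets M \<subseteq> sets (F 0) \<and>
     (\<forall>t\<ge>0. sets (F t) = (\<Inter>s\<in>{t<..}. sets (F s)))"

text \<open>Increments are independent of the past and have the product density of
  \<open>N(0, (t - s) I)\<close>.\<close>

definition brownian_motion ::
  "'w measure \<Rightarrow> (real \<Rightarrow> 'w measure) \<Rightarrow> (real \<Rightarrow> 'w \<Rightarrow> real^'m::finite) \<Rightarrow> bool" where
  "brownian_motion M F B \<longleftrightarrow>
     (\<forall>t\<ge>0. B t \<in> borel_measurable (F t)) \<and>
     (AE \<omega> in M. B 0 \<omega> = 0) \<and>
     (AE \<omega> in M. continuous_on {0..} (\<lambda>t. B t \<omega>)) \<and>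
     (\<forall>s t. 0 \<le> s \<and> s < t \<longrightarrow>
        prob_space.indep_set M
          (sets (vimage_algebra (space M) (\<lambda>\<omega>. B t \<omega> - B s \<omega>) borel)) (sets (F s)) \<and>
        distributed M lborel (\<lambda>\<omega>. B t \<omega> - B s \<omega>)
          (\<lambda>x. ennreal (\<Prod>i\<in>UNIV. normal_density 0 (sqrt (t - s)) (x $ i))))"

section \<open>The truncated Euler--Maruyama scheme\<close>

text \<open>At \<open>x = 0\<close> the unit vector \<open>x /\<^sub>R norm x\<close> is \<open>0\<close>.\<close>

definition truncation :: "real \<Rightarrow> real^'d::finite \<Rightarrow> real^'d" where
  "truncation R x = min (norm x) R *\<^sub>R (x /\<^sub>R norm x)"

text \<open>\<open>\<phi>\<close> is only constrained on \<open>{0..}\<close>, hence the restricted inverse.\<close>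

definition trunc_radius :: "(real \<Rightarrow> real) \<Rightarrow> real \<Rightarrow> real \<Rightarrow> real \<Rightarrow> real" where
  "trunc_radius \<phi> K \<theta> \<Delta> = the_inv_into {0..} \<phi> (K * \<Delta> powr (- \<theta>))"

primrec truncated_EM ::
  "(real^'d::finite \<Rightarrow> real^'d) \<Rightarrow> (real^'d \<Rightarrow> real^'m::finite^'d) \<Rightarrow> real^'d \<Rightarrow> (real \<Rightarrow> 'w \<Rightarrow> real^'m) \<Rightarrow>
   real \<Rightarrow> real \<Rightarrow> nat \<Rightarrow> 'w \<Rightarrow> real^'d" where
  "truncated_EM f g x0 B R \<Delta> 0 \<omega> = x0"
| "truncated_EM f g x0 B R \<Delta> (Suc k) \<omega> =
     (let z = truncated_EM f g x0 B R \<Delta> k \<omega>;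
          \<Delta>B = B (real (Suc k) * \<Delta>) \<omega> - B (real k * \<Delta>) \<omega>
      in truncation R (z + \<Delta> *\<^sub>R f z + g z *v \<Delta>B))"

end

theory Submission
  imports Defs
begin

text \<open>
The truncation keeps \<open>Z\<^sub>k\<close> in a fixed ball of radius \<open>R\<close> with \<open>\<phi> R = K \<Delta>\<^sup>-\<^sup>\<theta>\<close>, so \<open>V (Z\<^sub>k)\<close> is
bounded for each \<open>\<Delta>\<close>, and by compactness the distance of \<open>Z\<^sub>k\<close> to \<open>Ker w\<close> tends to \<open>0\<close> as soon as
\<open>w (Z\<^sub>k) \<rightarrow> 0\<close>. For the latter it suffices that the expected value of \<open>V\<close> drops by at least
\<open>\<Delta>/2 * E w (Z\<^sub>k)\<close> in every step: then \<open>E w (Z\<^sub>k)\<close> is summable over \<open>k\<close>, hence almost surely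
\<open>w (Z\<^sub>k)\<close> is summable. Since the Brownian increment is independent of \<open>Z\<^sub>k\<close>, Fubini reduces
the drop to a statement about one deterministic starting point \<open>z\<close> and a Gaussian integral,
\<open>one_step_drift\<close>.

For the one-step estimate, truncation only lowers \<open>V\<close>, because \<open>V\<close> does not increase under
scaling towards the origin. Write the untruncated step as \<open>a + b\<close> with \<open>a = \<Delta> f(z)\<close> and
\<open>b = g(z)\<xi>\<close>. Expand \<open>V\<close> to fourth order and average over \<open>\<xi>\<close> and \<open>-\<xi>\<close>, which kills all
terms odd in \<open>b\<close> (\<open>symmetrised_taylor_bound\<close>). The first-order term in \<open>a\<close> and the second-order
term in \<open>b\<close> integrate to \<open>\<Delta> LV(z) \<le> - \<Delta> w(z)\<close>. Every other term is bounded by a constant times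
\<open>(\<Delta> \<phi>(R))\<^sup>2 m\<close> with \<open>m = min (V z) (w z) = \<Lambda>\<^sub>1(z) V(z)\<close>. To see the scaling, let
\<open>l = (1 + V)\<^sup>\<delta>\<close>, \<open>n = 1/\<delta>\<close>, \<open>q = \<Delta> \<phi>(R)\<close> and \<open>\<kappa>\<^sup>2 = m / (1 + V) \<le> 1\<close>; the choice of \<open>\<phi>\<close>
gives \<open>\<bar>a\<bar> \<le> q \<kappa> l\<close> and \<open>\<bar>b\<bar> \<le> sqrt q \<kappa> l \<rho>\<close> with \<open>\<rho> = \<bar>\<xi>\<bar> / sqrt \<Delta>\<close>, while the \<open>k\<close>-th
derivatives are \<open>O(l^(n-k))\<close>. So a term of order \<open>k\<close> carries \<open>l^n \<kappa>\<^sup>k \<le> m\<close> (for \<open>k \<ge> 2\<close>) times a power of \<open>q\<close>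
whose exponent is at least \<open>2\<close> in all surviving error terms, provided \<open>q \<le> 1\<close>. The fourth order is
needed for this: a third-order remainder would contribute only \<open>q\<^sup>3\<^sup>/\<^sup>2\<close>. In the remainder the
derivative is taken at an intermediate point, which is harmless because \<open>l\<close> is globally Lipschitz
(\<open>level_lipschitz\<close>).

Finally \<open>q\<^sup>2 = K\<^sup>2 \<Delta>\<^sup>2\<^sup>-\<^sup>2\<^sup>\<theta>\<close> is \<open>o(\<Delta>)\<close> as \<open>\<theta> < 1/2\<close>, and \<open>m \<le> w(z)\<close>, so for small
\<open>\<Delta>\<close> the error is absorbed by half of \<open>\<Delta> w(z)\<close>.
\<close>

section \<open>Symmetry of higher partial derivatives\<close>

lemma cont_diff_imp_continuous: "cont_diff n V \<Longrightarrow> continuous_on UNIV V"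
  by (cases n) (auto intro: differentiable_imp_continuous_on)

lemma cont_diff_decrease: "cont_diff (Suc n) V \<Longrightarrow> cont_diff n V"
  by (induction n arbitrary: V) (auto intro: differentiable_imp_continuous_on)

lemma cont_diff_mono: "m \<le> n \<Longrightarrow> cont_diff n V \<Longrightarrow> cont_diff m V"
  by (induction rule: dec_induct) (auto dest: cont_diff_decrease simp del: cont_diff.simps)

lemma has_derivative_along_line:
  fixes V :: "real^'d::finite \<Rightarrow> real"
  assumes "V differentiable_on UNIV"
  shows "((\<lambda>t. V (z + t *\<^sub>R h)) has_real_derivative
           (\<Sum>i\<in>UNIV. h $ i * partial_deriv i V (z + t *\<^sub>R h))) (at t)"
proof -
  have dir: "((\<lambda>s. V (y + s *\<^sub>R k)) has_real_derivative D k) (at s)"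
    if D: "(V has_derivative D) (at (y + s *\<^sub>R k))" for D y k s
  proof -
    have "((\<lambda>s. V (y + s *\<^sub>R k)) has_derivative (\<lambda>u. D (u *\<^sub>R k))) (at s)"
      by (rule has_derivative_compose[where g = V and f = "\<lambda>s. y + s *\<^sub>R k", OF _ D])
        (auto intro!: derivative_eq_intros)
    moreover have "D (u *\<^sub>R k) = D k * u" for u
      using has_derivative_linear[OF D] by (simp add: linear_cmul)
    ultimately show ?thesis by (simp add: has_field_derivative_def)
  qed
  obtain D where D: "(V has_derivative D) (at (z + t *\<^sub>R h))"
    using assms by (auto simp: differentiable_on_def differentiable_def)
  have "partial_deriv i V (z + t *\<^sub>R h) = D (axis i 1)" for i
    using dir[of D "z + t *\<^sub>R h" 0 "axis i 1"] D
    by (auto simp: partial_deriv_def intro!: DERIV_imp_deriv)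
  moreover have "D h = (\<Sum>i\<in>UNIV. h $ i * D (axis i 1))"
  proof -
    have "D h = D (\<Sum>i\<in>UNIV. h $ i *\<^sub>R axis i 1)"
      by (simp add: basis_expansion[of h, unfolded scalar_mult_eq_scaleR])
    then show ?thesis
      using has_derivative_linear[OF D] by (simp add: linear_sum linear_cmul)
  qed
  ultimately show ?thesis using dir[OF D] by simp
qed

lemma has_derivative_along_axis:
  fixes V :: "real^'d::finite \<Rightarrow> real"
  assumes "V differentiable_on UNIV"
  shows "((\<lambda>t. V (z + t *\<^sub>R axis i 1)) has_real_derivative partial_deriv i V (z + t *\<^sub>R axis i 1)) (at t)"
proof -
  have "(\<Sum>j\<in>UNIV. (axis i 1 :: real^'d) $ j * partial_deriv j V y) = partial_deriv i V y" for y
    by (subst sum.remove[of _ i]) (auto simp: axis_def intro!: sum.neutral)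
  then show ?thesis using has_derivative_along_line[OF assms, of z "axis i 1" t] by simp
qed

text \<open>Applied with \<open>i\<close> and \<open>j\<close> exchanged, the left-hand side is the same, so the two mixed partial
derivatives agree at points arbitrarily close to \<open>x\<close>.\<close>

lemma second_difference_mean_value:
  fixes V :: "real^'d::finite \<Rightarrow> real"
  assumes V: "cont_diff 2 V" and h: "h > 0"
  shows "\<exists>p. dist p x \<le> 2 * h \<and>
     V (x + h *\<^sub>R axis i 1 + h *\<^sub>R axis j 1) - V (x + h *\<^sub>R axis i 1) - V (x + h *\<^sub>R axis j 1) + V x
       = h\<^sup>2 * partial_deriv j (partial_deriv i V) p"
proof -
  have V1: "V differentiable_on UNIV" "partial_deriv i V differentiable_on UNIV"
    using V by (auto simp: numeral_2_eq_2)
  define u where "u s = V ((x + h *\<^sub>R axis j 1) + s *\<^sub>R axis i 1) - V (x + s *\<^sub>R axis i 1)" for s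
  have "\<exists>s. 0 < s \<and> s < h \<and> u h - u 0 = (h - 0) *
     (partial_deriv i V ((x + h *\<^sub>R axis j 1) + s *\<^sub>R axis i 1) - partial_deriv i V (x + s *\<^sub>R axis i 1))"
    unfolding u_def using h V1 by (intro MVT2) (auto intro!: DERIV_diff has_derivative_along_axis)
  then obtain s where s: "0 < s" "s < h" "u h - u 0 = h *
     (partial_deriv i V ((x + h *\<^sub>R axis j 1) + s *\<^sub>R axis i 1) - partial_deriv i V (x + s *\<^sub>R axis i 1))"
    by auto
  let ?y = "x + s *\<^sub>R axis i 1"
  have "\<exists>t. 0 < t \<and> t < h \<and>
      partial_deriv i V (?y + h *\<^sub>R axis j 1) - partial_deriv i V (?y + 0 *\<^sub>R axis j 1)
       = (h - 0) * partial_deriv j (partial_deriv i V) (?y + t *\<^sub>R axis j 1)"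
    using h V1 by (intro MVT2) (auto intro!: has_derivative_along_axis)
  then obtain t where t: "0 < t" "t < h" and t':
      "partial_deriv i V (?y + h *\<^sub>R axis j 1) - partial_deriv i V ?y
       = h * partial_deriv j (partial_deriv i V) (?y + t *\<^sub>R axis j 1)"
    by auto
  have "dist (?y + t *\<^sub>R axis j 1) x \<le> norm (s *\<^sub>R axis i 1 :: real^'d) + norm (t *\<^sub>R axis j 1 :: real^'d)"
    using norm_triangle_ineq[of "s *\<^sub>R axis i 1" "t *\<^sub>R axis j 1 :: real^'d"]
    by (simp add: dist_norm add.assoc del: norm_scaleR)
  also have "\<dots> \<le> 2 * h" using s t by simp
  finally show ?thesis
    using s(3) t'
    by (intro exI[of _ "?y + t *\<^sub>R axis j 1"]) (simp add: u_def algebra_simps power2_eq_square)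
qed

lemma partial_deriv_commute:
  fixes V :: "real^'d::finite \<Rightarrow> real"
  assumes V: "cont_diff 2 V"
  shows "partial_deriv i (partial_deriv j V) = partial_deriv j (partial_deriv i V)"
proof
  fix x
  let ?A = "partial_deriv i (partial_deriv j V)" and ?B = "partial_deriv j (partial_deriv i V)"
  have cont: "isCont ?A x" "isCont ?B x"
    using V by (auto simp: numeral_2_eq_2 continuous_on_eq_continuous_at)
  have "\<forall>n. \<exists>p. dist p x \<le> 2 * (1 / real (Suc n)) \<and> (\<exists>q. dist q x \<le> 2 * (1 / real (Suc n)) \<and> ?A q = ?B p)"
  proof
    fix n
    let ?h = "1 / real (Suc n)"
    have h: "?h > 0" by simp
    have swap: "V (x + ?h *\<^sub>R axis j 1 + ?h *\<^sub>R axis i 1) - V (x + ?h *\<^sub>R axis j 1) - V (x + ?h *\<^sub>R axis i 1) + V x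
      = V (x + ?h *\<^sub>R axis i 1 + ?h *\<^sub>R axis j 1) - V (x + ?h *\<^sub>R axis i 1) - V (x + ?h *\<^sub>R axis j 1) + V x"
      by (simp add: add_ac)
    obtain p q where pq: "dist p x \<le> 2 * ?h" "dist q x \<le> 2 * ?h" and "?h\<^sup>2 * ?B p = ?h\<^sup>2 * ?A q"
      using second_difference_mean_value[OF V h, of x i j]
        second_difference_mean_value[OF V h, of x j i, unfolded swap]
      by metis
    then have "?A q = ?B p" by simp
    with pq show "\<exists>p. dist p x \<le> 2 * ?h \<and> (\<exists>q. dist q x \<le> 2 * ?h \<and> ?A q = ?B p)"
      by blast
  qed
  then obtain p q where pq: "\<And>n. dist (p n) x \<le> 2 * (1 / real (Suc n))"
      "\<And>n. dist (q n) x \<le> 2 * (1 / real (Suc n))" "\<And>n. ?A (q n) = ?B (p n)"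
    by metis
  have lim: "r \<longlonglongrightarrow> x" if "\<And>n. dist (r n) x \<le> 2 * (1 / real (Suc n))" for r
  proof -
    have z: "(\<lambda>n. 2 * (1 / real (Suc n))) \<longlonglongrightarrow> 2 * 0"
      by (rule tendsto_mult[OF tendsto_const LIMSEQ_Suc[OF lim_1_over_n]])
    have "(\<lambda>n. dist (r n) x) \<longlonglongrightarrow> 0"
      by (rule tendsto_sandwich[OF _ _ tendsto_const z[unfolded mult_zero_right]])
        (use that in \<open>auto intro!: always_eventually\<close>)
    then show ?thesis by (subst tendsto_dist_iff)
  qed
  have "(\<lambda>n. ?A (q n)) \<longlonglongrightarrow> ?A x" "(\<lambda>n. ?B (p n)) \<longlonglongrightarrow> ?B x"
    using isCont_tendsto_compose[OF cont(1) lim[OF pq(2)]] isCont_tendsto_compose[OF cont(2) lim[OF pq(1)]]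
    by auto
  then show "?A x = ?B x" using pq(3) LIMSEQ_unique by auto
qed

lemma cont_diff_foldr_partial_deriv:
  "cont_diff (n + length is) V \<Longrightarrow> cont_diff n (foldr partial_deriv is V)"
proof (induction "is" arbitrary: n)
  case (Cons i "is")
  have "cont_diff (Suc n) (foldr partial_deriv is V)"
    using Cons.IH[of "Suc n"] Cons.prems by simp
  then show ?case by simp
qed auto

lemma foldr_partial_deriv_move:
  assumes "cont_diff (length is + length js + 1) V"
  shows "foldr partial_deriv (is @ i # js) V = foldr partial_deriv (i # is @ js) V"
  using assms
proof (induction "is")
  case (Cons k "is")
  have "cont_diff 2 (foldr partial_deriv (is @ js) V)"
    using Cons.prems by (intro cont_diff_foldr_partial_deriv) (simp add: numeral_2_eq_2 del: cont_diff.simps)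
  moreover have "foldr partial_deriv (is @ i # js) V = foldr partial_deriv (i # is @ js) V"
    using Cons.prems by (intro Cons.IH) (auto intro: cont_diff_decrease simp del: cont_diff.simps)
  ultimately show ?case using partial_deriv_commute[of "foldr partial_deriv (is @ js) V" i k] by simp
qed auto

text \<open>The class bounds only the derivatives taken in the fixed order of \<^const>\<open>coords\<close>, whereas Taylor's
formula produces all orders; words of partial derivatives are therefore sorted.\<close>

lemma foldr_partial_deriv_permute:
  "mset is = mset js \<Longrightarrow> cont_diff (length is) V \<Longrightarrow> foldr partial_deriv is V = foldr partial_deriv js V"
proof (induction "is" arbitrary: js)
  case (Cons i "is")
  from Cons.prems have "i \<in> set js" by (metis list.set_intros(1) mset_eq_setD)
  then obtain as bs where js: "js = as @ i # bs" by (meson split_list)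
  have eq: "mset is = mset (as @ bs)" using Cons.prems by (simp add: js)
  have len: "length is = length as + length bs" using eq by (metis length_append mset_eq_length)
  have "foldr partial_deriv js V = partial_deriv i (foldr partial_deriv (as @ bs) V)"
    using Cons.prems(2) unfolding js by (subst foldr_partial_deriv_move) (auto simp: len simp del: cont_diff.simps)
  also have "foldr partial_deriv (as @ bs) V = foldr partial_deriv is V"
    using Cons.IH[OF eq] cont_diff_decrease[of "length is" V] Cons.prems(2) by (simp del: foldr_append)
  finally show ?case by simp
qed auto

lemma abs_foldr_partial_deriv_le:
  fixes V :: "real^'d::finite \<Rightarrow> real"
  assumes "cont_diff (length is) V"
  shows "\<bar>foldr partial_deriv is V x\<bar> \<le> deriv_norm (length is) V x"
proof -
  define \<alpha> where "\<alpha> i = count (mset is) i" for i :: 'd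
  have \<alpha>: "(\<Sum>i\<in>UNIV. \<alpha> i) = length is"
    unfolding \<alpha>_def size_mset[symmetric] size_multiset_overloaded_eq
    by (intro sum.mono_neutral_right) (auto simp: count_eq_zero_iff)
  have "\<exists>xs :: 'd list. distinct xs \<and> set xs = UNIV"
    using finite_distinct_list[of "UNIV :: 'd set"] by auto
  then have coords: "distinct (coords :: 'd list)" "set (coords :: 'd list) = UNIV"
    using someI_ex[of "\<lambda>xs :: 'd list. distinct xs \<and> set xs = UNIV"] unfolding coords_def by auto
  have word: "foldr (\<lambda>i. partial_deriv i ^^ \<alpha> i) cs V
      = foldr partial_deriv (concat (map (\<lambda>i. replicate (\<alpha> i) i) cs)) V" for cs
  proof -
    have "foldr partial_deriv (replicate n i) U = (partial_deriv i ^^ n) U" for n i and U :: "real^'d \<Rightarrow> real"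
      by (induction n) auto
    then show ?thesis by (induction cs) auto
  qed
  have "mset (concat (map (\<lambda>i. replicate (\<alpha> i) i) coords)) = mset is"
  proof (rule multiset_eqI)
    fix k
    have "count (mset (concat (map (\<lambda>i. replicate (\<alpha> i) i) cs))) k = (\<Sum>i\<leftarrow>cs. if i = k then \<alpha> i else 0)" for cs
      by (induction cs) auto
    also have "(\<Sum>i\<leftarrow>coords. if i = k then \<alpha> i else 0) = (\<Sum>i\<in>UNIV. if i = k then \<alpha> i else 0)"
      using coords by (simp add: sum_list_distinct_conv_sum_set)
    finally show "count (mset (concat (map (\<lambda>i. replicate (\<alpha> i) i) coords))) k = count (mset is) k"
      by (simp add: \<alpha>_def)
  qed
  then have "multi_deriv \<alpha> V = foldr partial_deriv is V"
    unfolding multi_deriv_def word using foldr_partial_deriv_permute[of "is"] assms by metis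
  moreover have "(multi_deriv \<alpha> V x)\<^sup>2 \<le> (\<Sum>\<alpha> | (\<Sum>i\<in>UNIV. \<alpha> i) = length is. (multi_deriv \<alpha> V x)\<^sup>2)"
    using \<alpha> by (intro member_le_sum) (auto simp: finite_multiindices)
  ultimately show ?thesis
    unfolding deriv_norm_def by (metis real_sqrt_abs real_sqrt_le_mono)
qed

section \<open>Taylor expansion along a segment\<close>

text \<open>The \<open>n\<close>-th differential evaluated on \<open>(h, \<dots>, h)\<close>. The direction \<open>h\<close> is kept out of the functions that
are differentiated, so that only partial derivatives of \<open>V\<close> itself occur.\<close>

fun deriv_form :: "nat \<Rightarrow> (real^'d::finite \<Rightarrow> real) \<Rightarrow> real^'d \<Rightarrow> real^'d \<Rightarrow> real" where
  "deriv_form 0 V h x = V x"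
| "deriv_form (Suc n) V h x = (\<Sum>i\<in>UNIV. h $ i * deriv_form n (partial_deriv i V) h x)"

lemma deriv_form_has_derivative:
  assumes "cont_diff (Suc n) V"
  shows "((\<lambda>t. deriv_form n V h (z + t *\<^sub>R h)) has_real_derivative deriv_form (Suc n) V h (z + t *\<^sub>R h)) (at t)"
  using assms
proof (induction n arbitrary: V)
  case 0
  then show ?case using has_derivative_along_line[of V z h t] by simp
next
  case (Suc n)
  have "((\<lambda>t. deriv_form n (partial_deriv i V) h (z + t *\<^sub>R h)) has_real_derivative
      deriv_form (Suc n) (partial_deriv i V) h (z + t *\<^sub>R h)) (at t)" for i
    using Suc by simp
  then show ?case
    unfolding deriv_form.simps(2)[of _ V] by (intro DERIV_sum DERIV_cmult)
qed

lemma taylor_deriv_form: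
  assumes "cont_diff n V" "n > 0"
  shows "\<exists>t. 0 < t \<and> t < 1 \<and>
    V (z + h) = (\<Sum>m<n. deriv_form m V h z / fact m) + deriv_form n V h (z + t *\<^sub>R h) / fact n"
proof -
  have "\<exists>t. 0 < t \<and> t < 1 \<and> V (z + 1 *\<^sub>R h) =
      (\<Sum>m<n. deriv_form m V h (z + 0 *\<^sub>R h) / fact m * 1 ^ m) + deriv_form n V h (z + t *\<^sub>R h) / fact n * 1 ^ n"
    using assms(2)
    by (intro Maclaurin[where diff = "\<lambda>m t. deriv_form m V h (z + t *\<^sub>R h)"])
      (auto intro!: deriv_form_has_derivative cont_diff_mono[OF _ assms(1)] simp del: deriv_form.simps(2) cont_diff.simps)
  then show ?thesis by simp
qed

lemma abs_deriv_form_le: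
  fixes V :: "real^'d::finite \<Rightarrow> real"
  assumes "\<And>is. length is = n \<Longrightarrow> \<bar>foldr partial_deriv is V x\<bar> \<le> A"
  shows "\<bar>deriv_form n V h x\<bar> \<le> (real CARD('d) * norm h) ^ n * A"
  using assms
proof (induction n arbitrary: V)
  case 0
  then show ?case by simp
next
  case (Suc n)
  have IH: "\<bar>deriv_form n (partial_deriv i V) h x\<bar> \<le> (real CARD('d) * norm h) ^ n * A" for i
  proof (rule Suc.IH)
    fix "is" :: "'d list" assume "length is = n"
    then show "\<bar>foldr partial_deriv is (partial_deriv i V) x\<bar> \<le> A"
      using Suc.prems[of "is @ [i]"] by simp
  qed
  have "\<bar>deriv_form (Suc n) V h x\<bar> \<le> (\<Sum>i\<in>UNIV. \<bar>h $ i * deriv_form n (partial_deriv i V) h x\<bar>)"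
    by simp
  also have "\<dots> \<le> (\<Sum>i::'d\<in>UNIV. norm h * ((real CARD('d) * norm h) ^ n * A))"
    unfolding abs_mult by (intro sum_mono mult_mono component_le_norm_cart IH) auto
  finally have "\<bar>deriv_form (Suc n) V h x\<bar> \<le> (\<Sum>i::'d\<in>UNIV. norm h * ((real CARD('d) * norm h) ^ n * A))" .
  then show ?case by (simp add: mult_ac)
qed

section \<open>Gaussian integrals on Euclidean space\<close>

lemma
  fixes f :: "'m::finite \<Rightarrow> real \<Rightarrow> real"
  assumes f: "\<And>i. integrable lborel (f i)"
  shows integrable_lborel_vec_prod: "integrable lborel (\<lambda>x::real^'m. \<Prod>i\<in>UNIV. f i (x $ i))"
    and integral_lborel_vec_prod: "(\<integral>x. (\<Prod>i\<in>UNIV. f i (x $ i)) \<partial>(lborel :: (real^'m) measure)) = (\<Prod>i\<in>UNIV. \<integral>x. f i x \<partial>lborel)"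
proof -
  interpret product_sigma_finite "\<lambda>_::real^'m. lborel :: real measure" ..
  have Basis: "(Basis :: (real^'m) set) = range (\<lambda>i. axis i 1)"
    by (auto simp: Basis_vec_def)
  have inj: "inj (\<lambda>i::'m. axis i (1::real))"
    by (auto simp: inj_on_def axis_eq_axis)
  have prod: "(\<Prod>b\<in>Basis. h b) = (\<Prod>i\<in>UNIV. h (axis i 1))" for h :: "real^'m \<Rightarrow> real"
    unfolding Basis using inj by (simp add: prod.reindex)
  have comp: "(\<Sum>b\<in>Basis. F b *\<^sub>R b) $ i = F (axis i 1)" for F :: "real^'m \<Rightarrow> real" and i
  proof -
    have "(\<Sum>b\<in>Basis. F b *\<^sub>R b) $ i = (\<Sum>b\<in>Basis. F b * b $ i)"
      by simp
    also have "\<dots> = (\<Sum>j\<in>UNIV. F (axis j 1) * axis j 1 $ i)"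
      unfolding Basis using inj by (simp add: sum.reindex)
    also have "\<dots> = F (axis i 1)"
      by (subst sum.remove[of _ i]) (auto simp: axis_def intro!: sum.neutral)
    finally show ?thesis .
  qed
  have T: "(\<lambda>F. \<Sum>b\<in>Basis. F b *\<^sub>R b) \<in> measurable (\<Pi>\<^sub>M b\<in>(Basis :: (real^'m) set). lborel) borel"
    by measurable
  have [measurable]: "f i \<in> borel_measurable borel" for i
    using f[of i] by (auto dest: borel_measurable_integrable)
  have m: "(\<lambda>x::real^'m. \<Prod>i\<in>UNIV. f i (x $ i)) \<in> borel_measurable borel"
    by measurable
  have eq: "(\<Prod>i\<in>UNIV. f i ((\<Sum>b\<in>Basis. F b *\<^sub>R b) $ i)) = (\<Prod>b\<in>Basis. f (axis_index b) (F b))" for F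
    unfolding prod comp by (simp add: axis_index_axis)
  show "integrable lborel (\<lambda>x::real^'m. \<Prod>i\<in>UNIV. f i (x $ i))"
    unfolding lborel_eq[where 'a = "real^'m"] integrable_distr_eq[OF T m] eq
    by (rule product_integrable_prod) (auto intro: f)
  show "(\<integral>x. (\<Prod>i\<in>UNIV. f i (x $ i)) \<partial>(lborel :: (real^'m) measure)) = (\<Prod>i\<in>UNIV. \<integral>x. f i x \<partial>lborel)"
    unfolding lborel_eq[where 'a = "real^'m"] integral_distr[OF T m] eq
    by (subst product_integral_prod) (auto intro: f simp: prod axis_index_axis)
qed

definition gauss :: "real \<Rightarrow> (real^'m::finite) measure" where
  "gauss \<sigma> = density lborel (\<lambda>x. ennreal (\<Prod>i\<in>UNIV. normal_density 0 \<sigma> (x $ i)))"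

lemma sets_gauss[simp, measurable_cong]: "sets (gauss \<sigma>) = sets borel"
  and space_gauss[simp]: "space (gauss \<sigma>) = UNIV"
  by (simp_all add: gauss_def)

lemma normal_prod_measurable[measurable]:
  "(\<lambda>x::real^'m::finite. \<Prod>i\<in>UNIV. normal_density 0 \<sigma> (x $ i)) \<in> borel_measurable borel"
  by measurable

lemma
  fixes h :: "'m::finite \<Rightarrow> real \<Rightarrow> real"
  assumes h: "\<And>i. integrable lborel (\<lambda>x. normal_density 0 \<sigma> x * h i x)"
    and m[measurable]: "\<And>i. h i \<in> borel_measurable borel"
  shows integrable_gauss_prod: "integrable (gauss \<sigma>) (\<lambda>x::real^'m. \<Prod>i\<in>UNIV. h i (x $ i))"
    and integral_gauss_prod: "(\<integral>x. (\<Prod>i\<in>UNIV. h i (x $ i)) \<partial>(gauss \<sigma> :: (real^'m) measure)) =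
      (\<Prod>i\<in>UNIV. \<integral>x. normal_density 0 \<sigma> x * h i x \<partial>lborel)"
  using integrable_lborel_vec_prod[OF h] integral_lborel_vec_prod[OF h] unfolding gauss_def
  by (simp_all add: integrable_density integral_density prod_nonneg prod.distrib)

lemma prob_space_gauss:
  assumes "\<sigma> > 0"
  shows "prob_space (gauss \<sigma> :: (real^'m::finite) measure)"
proof
  let ?p = "\<lambda>x::real^'m. \<Prod>i\<in>UNIV. normal_density 0 \<sigma> (x $ i)"
  have "emeasure (gauss \<sigma> :: (real^'m) measure) (space (gauss \<sigma>)) = (\<integral>\<^sup>+x. ennreal (?p x) \<partial>lborel)"
    by (simp add: gauss_def emeasure_density)
  also have "\<dots> = ennreal (\<integral>x. ?p x \<partial>lborel)"
    using assms by (intro nn_integral_eq_integral integrable_lborel_vec_prod) (auto intro!: prod_nonneg)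
  also have "(\<integral>x. ?p x \<partial>lborel) = 1"
    using assms by (subst integral_lborel_vec_prod) auto
  finally show "emeasure (gauss \<sigma> :: (real^'m) measure) (space (gauss \<sigma>)) = 1" by simp
qed

lemma
  fixes i j :: "'m::finite"
  assumes \<sigma>: "\<sigma> > 0"
  shows integrable_gauss_mult: "integrable (gauss \<sigma> :: (real^'m) measure) (\<lambda>x. x $ i * x $ j)"
    and integral_gauss_mult: "(\<integral>x. x $ i * x $ j \<partial>(gauss \<sigma> :: (real^'m) measure)) = (if i = j then \<sigma>\<^sup>2 else 0)"
proof -
  define h where "h k x = (if k = i then x else 1) * (if k = j then x else 1)" for k :: 'm and x :: real
  have pow: "integrable lborel (\<lambda>x. normal_density 0 \<sigma> x * x)" "integrable lborel (\<lambda>x. normal_density 0 \<sigma> x * (x * x))"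
    using integrable_normal_moment[OF \<sigma>, of 0 1] integrable_normal_moment[OF \<sigma>, of 0 2]
    by (simp_all add: power2_eq_square)
  have int: "integrable lborel (\<lambda>x. normal_density 0 \<sigma> x * h k x)" for k
    unfolding h_def using \<sigma> pow by (cases "k = i"; cases "k = j") auto
  have meas: "h k \<in> borel_measurable borel" for k
    unfolding h_def by measurable
  have prod: "(\<Prod>k\<in>UNIV. h k (x $ k)) = x $ i * x $ j" for x :: "real^'m"
    unfolding h_def prod.distrib by simp
  show "integrable (gauss \<sigma> :: (real^'m) measure) (\<lambda>x. x $ i * x $ j)"
    using integrable_gauss_prod[where h = h, OF int meas] unfolding prod .
  have "(\<integral>x. x $ i * x $ j \<partial>(gauss \<sigma> :: (real^'m) measure)) = (\<Prod>k\<in>UNIV. \<integral>x. normal_density 0 \<sigma> x * h k x \<partial>lborel)"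
    using integral_gauss_prod[where h = h, OF int meas] unfolding prod .
  also have "\<dots> = (if i = j then \<sigma>\<^sup>2 else 0)"
  proof (cases "i = j")
    case True
    have "(\<integral>x. normal_density 0 \<sigma> x * h k x \<partial>lborel) = (if k = i then \<sigma>\<^sup>2 else 1)" for k
      using \<sigma> integral_normal_moment_even[OF \<sigma>, of 0 1] True
      by (simp add: h_def power2_eq_square fact_numeral)
    then show ?thesis using True by simp
  next
    case False
    have "(\<integral>x. normal_density 0 \<sigma> x * h i x \<partial>lborel) = 0"
      using integral_normal_moment_odd[OF \<sigma>, of 0 0] False by (simp add: h_def)
    then have "(\<Prod>k\<in>UNIV. \<integral>x. normal_density 0 \<sigma> x * h k x \<partial>lborel) = 0"
      by (intro prod_zero) auto
    then show ?thesis using False by simp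
  qed
  finally show "(\<integral>x. x $ i * x $ j \<partial>(gauss \<sigma> :: (real^'m) measure)) = (if i = j then \<sigma>\<^sup>2 else 0)" .
qed

text \<open>The functions \<open>(1 + \<bar>x\<bar>)^n\<close> and their products over the coordinates dominate the Taylor errors. After
division by the standard deviation their integral no longer depends on it, which gives
constants uniform in the step size.\<close>

lemma integrable_std_normal_one_plus_abs:
  "integrable lborel (\<lambda>x. std_normal_density x * (1 + \<bar>x\<bar>) ^ n)"
proof -
  have "integrable lborel (\<lambda>x. \<Sum>k\<le>n. std_normal_density x * \<bar>x\<bar> ^ k * real (n choose k))"
    by (intro Bochner_Integration.integrable_sum integrable_mult_left integrable_std_normal_moment_abs)
  moreover have "(\<Sum>k\<le>n. std_normal_density x * \<bar>x\<bar> ^ k * real (n choose k)) = std_normal_density x * (1 + \<bar>x\<bar>) ^ n" for x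
    using binomial_ring[of "\<bar>x\<bar>" 1 n] by (simp add: sum_distrib_left mult_ac add.commute)
  ultimately show ?thesis by simp
qed

lemma
  fixes n :: nat
  assumes \<sigma>: "\<sigma> > 0"
  shows integrable_normal_one_plus_abs: "integrable lborel (\<lambda>x. normal_density 0 \<sigma> x * (1 + \<bar>x\<bar> / \<sigma>) ^ n)"
    and integral_normal_one_plus_abs: "(\<integral>x. normal_density 0 \<sigma> x * (1 + \<bar>x\<bar> / \<sigma>) ^ n \<partial>lborel) = (\<integral>x. std_normal_density x * (1 + \<bar>x\<bar>) ^ n \<partial>lborel)"
proof -
  have scale: "normal_density 0 \<sigma> (0 + \<sigma> * x) * (1 + \<bar>0 + \<sigma> * x\<bar> / \<sigma>) ^ n = (std_normal_density x * (1 + \<bar>x\<bar>) ^ n) / \<sigma>" for x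
    using \<sigma> by (simp add: normal_density_def abs_mult power_mult_distrib real_sqrt_mult)
  show "integrable lborel (\<lambda>x. normal_density 0 \<sigma> x * (1 + \<bar>x\<bar> / \<sigma>) ^ n)"
    using \<sigma> integrable_std_normal_one_plus_abs[of n]
    by (subst lborel_integrable_real_affine_iff[of \<sigma> _ 0, symmetric]) (auto simp: scale simp del: add_0)
  show "(\<integral>x. normal_density 0 \<sigma> x * (1 + \<bar>x\<bar> / \<sigma>) ^ n \<partial>lborel) = (\<integral>x. std_normal_density x * (1 + \<bar>x\<bar>) ^ n \<partial>lborel)"
    using \<sigma> by (subst lborel_integral_real_affine[of \<sigma> _ 0]) (auto simp: scale simp del: add_0)
qed

text \<open>This symmetry lets the expansion be averaged over \<open>x\<close> and \<open>-x\<close> before it is integrated.\<close>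

lemma integral_gauss_uminus:
  fixes h :: "real^'m::finite \<Rightarrow> real"
  assumes [measurable]: "h \<in> borel_measurable borel"
  shows "(\<integral>x. h (- x) \<partial>gauss \<sigma>) = (\<integral>x. h x \<partial>gauss \<sigma>)"
    and "integrable (gauss \<sigma>) h \<Longrightarrow> integrable (gauss \<sigma>) (\<lambda>x. h (- x))"
proof -
  let ?p = "\<lambda>x::real^'m. \<Prod>i\<in>UNIV. normal_density 0 \<sigma> (x $ i)"
  have p: "?p (- x) = ?p x" for x
    by (simp add: normal_density_def)
  have lb: "distr lborel borel uminus = (lborel :: (real^'m) measure)"
    using lborel_affine[of "-1" "0 :: real^'m"] by (simp add: density_1 fun_Compl_def)
  have um: "uminus \<in> measurable (lborel :: (real^'m) measure) borel"
    by measurable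
  have nn: "0 \<le> ?p x" for x
    by (simp add: prod_nonneg)
  have "(\<integral>x. h x \<partial>gauss \<sigma>) = (\<integral>x. ?p x * h x \<partial>distr lborel borel uminus)"
    unfolding gauss_def lb by (subst integral_density) (auto simp: nn)
  also have "\<dots> = (\<integral>x. ?p (- x) * h (- x) \<partial>lborel)"
    by (rule integral_distr[OF um]) measurable
  also have "\<dots> = (\<integral>x. h (- x) \<partial>gauss \<sigma>)"
    unfolding gauss_def p by (subst integral_density) (auto simp: nn)
  finally show "(\<integral>x. h (- x) \<partial>gauss \<sigma>) = (\<integral>x. h x \<partial>gauss \<sigma>)" ..
  assume "integrable (gauss \<sigma>) h"
  then have "integrable (distr lborel borel uminus) (\<lambda>x. ?p x * h x)"
    unfolding gauss_def lb by (subst (asm) integrable_density) (auto simp: nn)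
  then have "integrable lborel (\<lambda>x. ?p (- x) * h (- x))"
    by (subst (asm) integrable_distr_eq[OF um]) measurable
  then show "integrable (gauss \<sigma>) (\<lambda>x. h (- x))"
    unfolding gauss_def p by (subst integrable_density) (auto simp: nn)
qed

section \<open>A symmetrised Taylor bound for Lyapunov functions\<close>

lemma deriv_form_1: "deriv_form 1 V h x = gradient V x \<bullet> h"
  by (simp add: gradient_def inner_vec_def mult.commute)

lemma deriv_form_2: "deriv_form 2 V h x = (\<Sum>i\<in>UNIV. \<Sum>j\<in>UNIV. h $ i * h $ j * partial_deriv j (partial_deriv i V) x)"
  by (simp add: numeral_2_eq_2 sum_distrib_left mult.assoc)

lemma deriv_form_3: "deriv_form 3 V h x =
   (\<Sum>i\<in>UNIV. \<Sum>j\<in>UNIV. \<Sum>k\<in>UNIV. h $ i * h $ j * h $ k * foldr partial_deriv [k, j, i] V x)"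
  by (simp add: numeral_3_eq_3 sum_distrib_left mult.assoc)

lemma deriv_form_2_parallelogram:
  "deriv_form 2 V (a + b) x + deriv_form 2 V (a - b) x = 2 * deriv_form 2 V a x + 2 * deriv_form 2 V b x"
  unfolding deriv_form_2 sum.distrib[symmetric] sum_distrib_left
  by (intro sum.cong refl) (simp add: algebra_simps)

text \<open>The terms containing an odd number of factors \<open>b\<close> cancel; only \<open>aaa\<close> and the three arrangements of
\<open>abb\<close> remain.\<close>

lemma abs_deriv_form_3_symmetrised_le:
  fixes V :: "real^'d::finite \<Rightarrow> real"
  assumes A: "\<And>is. length is = 3 \<Longrightarrow> \<bar>foldr partial_deriv is V x\<bar> \<le> A"
  shows "\<bar>deriv_form 3 V (a + b) x + deriv_form 3 V (a - b) x\<bar>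
    \<le> real CARD('d) ^ 3 * (2 * (norm a ^ 3 + 3 * norm a * (norm b)\<^sup>2) * A)"
proof -
  have comp: "\<bar>a $ i\<bar> \<le> norm a" "\<bar>b $ i\<bar> \<le> norm b" for i
    by (rule component_le_norm_cart)+
  let ?p = "\<lambda>i j k. (a $ i + b $ i) * (a $ j + b $ j) * (a $ k + b $ k) + (a $ i - b $ i) * (a $ j - b $ j) * (a $ k - b $ k)"
  have prod: "\<bar>?p i j k\<bar> \<le> 2 * (norm a ^ 3 + 3 * norm a * (norm b)\<^sup>2)" for i j k
  proof -
    have "?p i j k = 2 * (a $ i * a $ j * a $ k + a $ i * b $ j * b $ k + b $ i * a $ j * b $ k + b $ i * b $ j * a $ k)"
      by (simp add: algebra_simps)
    also have "\<bar>\<dots>\<bar> = 2 * \<bar>a $ i * a $ j * a $ k + a $ i * b $ j * b $ k + b $ i * a $ j * b $ k + b $ i * b $ j * a $ k\<bar>"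
      by (simp only: abs_mult abs_numeral)
    also have "\<dots> \<le> 2 * (\<bar>a $ i * a $ j * a $ k\<bar> + \<bar>a $ i * b $ j * b $ k\<bar> + \<bar>b $ i * a $ j * b $ k\<bar> + \<bar>b $ i * b $ j * a $ k\<bar>)"
      by (intro mult_left_mono) (auto intro: abs_triangle_ineq[THEN order_trans])
    also have "\<dots> \<le> 2 * (norm a * norm a * norm a + norm a * norm b * norm b + norm b * norm a * norm b + norm b * norm b * norm a)"
      unfolding abs_mult by (intro mult_left_mono add_mono mult_mono comp) auto
    also have "\<dots> = 2 * (norm a ^ 3 + 3 * norm a * (norm b)\<^sup>2)"
      by (simp add: power2_eq_square power3_eq_cube)
    finally show ?thesis .
  qed
  have "\<bar>deriv_form 3 V (a + b) x + deriv_form 3 V (a - b) x\<bar>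
     = \<bar>\<Sum>i\<in>UNIV. \<Sum>j\<in>UNIV. \<Sum>k\<in>UNIV. ?p i j k * foldr partial_deriv [k, j, i] V x\<bar>"
    unfolding deriv_form_3 sum.distrib[symmetric]
    by (intro arg_cong[where f = abs] sum.cong refl) (simp add: algebra_simps del: foldr.simps)
  also have "\<dots> \<le> (\<Sum>i\<in>UNIV. \<Sum>j\<in>UNIV. \<Sum>k\<in>UNIV. \<bar>?p i j k * foldr partial_deriv [k, j, i] V x\<bar>)"
    by (intro order_trans[OF sum_abs] sum_mono order_refl)
  also have "\<dots> \<le> (\<Sum>i::'d\<in>UNIV. \<Sum>j::'d\<in>UNIV. \<Sum>k::'d\<in>UNIV. 2 * (norm a ^ 3 + 3 * norm a * (norm b)\<^sup>2) * A)"
    unfolding abs_mult by (intro sum_mono mult_mono prod A) auto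
  also have "\<dots> = real CARD('d) ^ 3 * (2 * (norm a ^ 3 + 3 * norm a * (norm b)\<^sup>2) * A)"
    by (simp add: power3_eq_cube)
  finally show ?thesis .
qed

text \<open>With \<open>\<delta> = 1 / n\<close> this is \<open>(1 + V)\<^sup>\<delta>\<close>. As \<open>n\<close> is an integer, all real powers in the growth conditions
become natural powers of it.\<close>

definition level :: "nat \<Rightarrow> ('a \<Rightarrow> real) \<Rightarrow> 'a \<Rightarrow> real" where
  "level n V x = (1 + V x) powr (1 / real n)"

lemma level_power:
  assumes "0 \<le> V x" "k \<le> n" "n > 0"
  shows "level n V x ^ (n - k) = (1 + V x) powr (1 - real k * (1 / real n))"
proof -
  have "level n V x ^ (n - k) = (1 + V x) powr (1 / real n * real (n - k))"
    using assms(1) unfolding level_def powr_powr[symmetric] by (subst powr_realpow) (auto simp: add_nonneg_eq_0_iff)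
  also have "1 / real n * real (n - k) = 1 - real k * (1 / real n)"
    using assms by (simp add: of_nat_diff field_simps)
  finally show ?thesis .
qed

lemma level_ge_1: "0 \<le> V x \<Longrightarrow> 1 \<le> level n V x"
  by (simp add: level_def ge_one_powr_ge_zero)

text \<open>The growth conditions of the Lyapunov class of order four, for partial derivatives in arbitrary order.\<close>

definition derivs_bounded :: "nat \<Rightarrow> real \<Rightarrow> (real^'d::finite \<Rightarrow> real) \<Rightarrow> bool" where
  "derivs_bounded n c V \<longleftrightarrow> cont_diff 4 V \<and> (\<forall>x. 0 \<le> V x) \<and> 0 < c \<and> 4 \<le> n \<and>
     (\<forall>is x. 1 \<le> length is \<and> length is \<le> 4 \<longrightarrow>
        \<bar>foldr partial_deriv is V x\<bar> \<le> c * level n V x ^ (n - length is))"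

lemma derivs_bounded_lyapunov:
  fixes V :: "real^'d::finite \<Rightarrow> real"
  assumes "V \<in> lyapunov_class 4 (1 / real n)" "4 \<le> n"
  shows "\<exists>c. derivs_bounded n c V"
proof -
  obtain c where c: "c > 0" "\<And>k x. k \<in> {1..4} \<Longrightarrow> deriv_norm k V x \<le> c * (1 + V x) powr (1 - real k * (1 / real n))"
    and V: "cont_diff 4 V" "\<And>x. 0 \<le> V x"
    using assms unfolding lyapunov_class_def by blast
  have "\<bar>foldr partial_deriv is V x\<bar> \<le> c * level n V x ^ (n - length is)"
    if "1 \<le> length is" "length is \<le> 4" for "is" x
    using abs_foldr_partial_deriv_le[of "is" V x] c(2)[of "length is" x] cont_diff_mono[OF that(2) V(1)]
      level_power[of V x "length is" n] V(2) that assms(2) by auto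
  then show ?thesis using c V assms unfolding derivs_bounded_def by blast
qed

text \<open>The gradient of the level is \<open>\<delta> (1 + V)\<^sup>\<delta>\<^sup>-\<^sup>1 \<nabla>V\<close>, and the condition on the first derivatives of \<open>V\<close> bounds
exactly this product.\<close>

lemma level_lipschitz:
  fixes V :: "real^'d::finite \<Rightarrow> real"
  assumes V: "derivs_bounded n c V"
  shows "level n V (z + h) \<le> level n V z + c * real CARD('d) * norm h"
proof -
  have nn: "0 \<le> V x" for x using V by (auto simp: derivs_bounded_def)
  have n: "4 \<le> n" and c: "c > 0" and diff: "cont_diff 4 V"
    using V unfolding derivs_bounded_def by blast+
  define u where "u t = V (z + t *\<^sub>R h)" for t
  have du: "(u has_real_derivative deriv_form 1 V h (z + t *\<^sub>R h)) (at t)" for t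
    unfolding u_def using deriv_form_has_derivative[of 0 V h z t] cont_diff_mono[OF _ diff, of 1] by simp
  have "\<exists>t. 0 < t \<and> t < 1 \<and> level n V (z + 1 *\<^sub>R h) - level n V (z + 0 *\<^sub>R h)
     = (1 - 0) * (1 / real n * (1 + u t) powr (1 / real n - 1) * deriv_form 1 V h (z + t *\<^sub>R h))"
  proof (rule MVT2)
    fix t :: real
    have "0 < 1 + u t" using nn[of "z + t *\<^sub>R h"] by (simp add: u_def)
    then show "((\<lambda>t. level n V (z + t *\<^sub>R h)) has_real_derivative
        1 / real n * (1 + u t) powr (1 / real n - 1) * deriv_form 1 V h (z + t *\<^sub>R h)) (at t)"
      unfolding level_def u_def[symmetric] using du[of t]
      by (auto intro!: derivative_eq_intros has_real_derivative_powr[THEN DERIV_chain2])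
  qed simp
  then obtain t where t: "level n V (z + h) - level n V z
     = 1 / real n * (1 + u t) powr (1 / real n - 1) * deriv_form 1 V h (z + t *\<^sub>R h)"
    by auto
  let ?y = "z + t *\<^sub>R h"
  have "\<bar>foldr partial_deriv is V ?y\<bar> \<le> c * level n V ?y ^ (n - 1)" if "length is = 1" for "is"
    using V that unfolding derivs_bounded_def by (metis One_nat_def le_refl le_numeral_extra(4) one_le_numeral)
  from abs_deriv_form_le[of 1 V ?y, OF this]
  have "deriv_form 1 V h ?y \<le> real CARD('d) * norm h * (c * (1 + u t) powr (1 - 1 / real n))"
    using level_power[of V ?y 1 n] nn n by (simp add: u_def abs_le_iff)
  then have "(1 + u t) powr (1 / real n - 1) * deriv_form 1 V h ?y
     \<le> (1 + u t) powr (1 / real n - 1) * (real CARD('d) * norm h * (c * (1 + u t) powr (1 - 1 / real n)))"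
    by (intro mult_left_mono) auto
  also have "\<dots> = c * real CARD('d) * norm h * ((1 + u t) powr (1 / real n - 1) * (1 + u t) powr (1 - 1 / real n))"
    by (simp only: mult_ac)
  also have "(1 + u t) powr (1 / real n - 1) * (1 + u t) powr (1 - 1 / real n) = 1"
    using nn[of ?y] unfolding powr_add[symmetric] by (simp add: u_def add_nonneg_eq_0_iff)
  finally have "(1 + u t) powr (1 / real n - 1) * deriv_form 1 V h ?y \<le> c * real CARD('d) * norm h"
    by simp
  then have "1 / real n * ((1 + u t) powr (1 / real n - 1) * deriv_form 1 V h ?y) \<le> 1 / real n * (c * real CARD('d) * norm h)"
    by (intro mult_left_mono) auto
  also have "\<dots> \<le> 1 * (c * real CARD('d) * norm h)"
    using n c by (intro mult_right_mono) auto
  finally show ?thesis using t by simp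
qed

text \<open>The summands account for the errors of second, third and fourth order; the power of \<open>1 + c * real d\<close>
is the growth of the level up to the intermediate point of the Taylor remainder.\<close>

definition taylor_const :: "nat \<Rightarrow> nat \<Rightarrow> real \<Rightarrow> real" where
  "taylor_const d n c = c * real d ^ 2 + c * real d ^ 3 + c * real d ^ 4 * (1 + c * real d) ^ (n - 4)"

text \<open>The hypotheses express the sizes of the deterministic part \<open>a\<close> and the noise part \<open>b\<close> of a step
relative to the level: \<open>q\<close> is the small parameter, \<open>\<rho>\<close> the normalised size of the noise, and
\<open>\<kappa>\<^sup>2 (1 + V z)\<close> will be \<open>min (V z) (w z)\<close>. Every error term has \<open>k \<ge> 2\<close> factors of size \<open>\<kappa> l\<close> against a
derivative of size \<open>l^(n-k)\<close>, and carries at least \<open>q\<^sup>2\<close>: each \<open>a\<close> contributes \<open>q\<close>, each \<open>b\<close>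
contributes \<open>sqrt q\<close>, and the combination \<open>abb\<close> is the worst one in third order. The growth in \<open>\<rho>\<close> is of degree
at most \<open>n\<close> since in the remainder \<open>n - 4\<close> further powers come from the intermediate point.\<close>

lemma symmetrised_taylor_bound:
  fixes V :: "real^'d::finite \<Rightarrow> real"
  assumes V: "derivs_bounded n c V"
    and q: "0 \<le> q" "q \<le> 1" and \<kappa>: "0 \<le> \<kappa>" "\<kappa> \<le> 1" and \<rho>: "0 \<le> \<rho>"
    and a: "norm a \<le> q * (\<kappa> * level n V z)" and b: "norm b \<le> sqrt q * (\<kappa> * level n V z) * \<rho>"
  shows "(V (z + (a + b)) + V (z + (a - b))) / 2 \<le>
    V z + gradient V z \<bullet> a + deriv_form 2 V b z / 2
      + taylor_const CARD('d) n c * (q\<^sup>2 * (\<kappa>\<^sup>2 * level n V z ^ n) * (1 + \<rho>) ^ n)"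
proof -
  have nn: "0 \<le> V x" for x using V by (auto simp: derivs_bounded_def)
  have n: "4 \<le> n" and c: "c > 0" and diff: "cont_diff 4 V"
    using V unfolding derivs_bounded_def by blast+
  have word: "\<bar>foldr partial_deriv is V x\<bar> \<le> c * level n V x ^ (n - k)" if "length is = k" "1 \<le> k" "k \<le> 4" for "is" k x
    using V that unfolding derivs_bounded_def by auto
  define l where "l = level n V z"
  define D where "D = real CARD('d)"
  define E where "E = q\<^sup>2 * (\<kappa>\<^sup>2 * l ^ n) * (1 + \<rho>) ^ n"
  define s where "s = sqrt q * (\<kappa> * l)"
  have l: "1 \<le> l" unfolding l_def by (rule level_ge_1) (rule nn)
  have D: "0 < D" unfolding D_def by simp
  have sq: "0 \<le> sqrt q" "sqrt q \<le> 1" "sqrt q ^ 2 = q" "sqrt q ^ 4 = q\<^sup>2" "q \<le> sqrt q"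
    using q real_sqrt_pow2[of q] power2_eq_square power_mult[of "sqrt q" 2 2]
    by (auto simp: real_le_rsqrt power_le_one real_le_lsqrt power2_eq_square mult_left_le)
  have s: "0 \<le> s" "norm a \<le> sqrt q * s" "norm b \<le> s * \<rho>" "norm a \<le> s" "s \<le> l" 
  proof -
    show "0 \<le> s" using sq \<kappa> l by (simp add: s_def)
    have "sqrt q * s = (sqrt q)\<^sup>2 * (\<kappa> * l)" by (simp only: s_def power2_eq_square mult.assoc)
    then show a': "norm a \<le> sqrt q * s" using a sq(3) by (simp add: l_def)
    show "norm b \<le> s * \<rho>" using b by (simp add: s_def l_def)
    have "sqrt q * s \<le> 1 * s" using sq \<open>0 \<le> s\<close> by (intro mult_right_mono) auto
    then show "norm a \<le> s" using a' by simp
    have "s \<le> 1 * (1 * l)" unfolding s_def using sq \<kappa> l by (intro mult_mono) auto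
    then show "s \<le> l" by simp
  qed
  have split: "x ^ k * x ^ (n - k) = x ^ n" if "k \<le> n" for x :: real and k
    using that by (metis le_add_diff_inverse power_add)
  have pow\<rho>: "(1 + \<rho>) ^ k \<le> (1 + \<rho>) ^ n" if "k \<le> n" for k
    using that \<rho> by (intro power_increasing) auto
  have E: "x \<le> 1 \<Longrightarrow> 0 \<le> x \<Longrightarrow> k \<le> n \<Longrightarrow> q\<^sup>2 * (\<kappa>\<^sup>2 * l ^ n) * x * (1 + \<rho>) ^ k \<le> E" for x k
  proof -
    assume x: "x \<le> 1" "0 \<le> x" "k \<le> n"
    have "q\<^sup>2 * (\<kappa>\<^sup>2 * l ^ n) * x * (1 + \<rho>) ^ k \<le> q\<^sup>2 * (\<kappa>\<^sup>2 * l ^ n) * 1 * (1 + \<rho>) ^ n"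
      using x \<rho> l by (intro mult_mono pow\<rho> order_refl mult_nonneg_nonneg) auto
    then show ?thesis by (simp add: E_def)
  qed
  have E0: "0 \<le> E" using l \<rho> by (simp add: E_def)

  \<comment> \<open>the part of the quadratic term that the generator does not contain\<close>
  have second: "deriv_form 2 V a z \<le> c * D\<^sup>2 * E"
  proof -
    have "deriv_form 2 V a z \<le> (D * norm a)\<^sup>2 * (c * l ^ (n - 2))"
      using abs_deriv_form_le[OF word, of 2 2 a z] unfolding D_def l_def by simp
    also have "\<dots> \<le> (D * (q * (\<kappa> * l)))\<^sup>2 * (c * l ^ (n - 2))"
      using a D c l unfolding l_def[symmetric] by (intro mult_right_mono power_mono mult_left_mono) auto
    also have "\<dots> = c * D\<^sup>2 * (q\<^sup>2 * (\<kappa>\<^sup>2 * (l\<^sup>2 * l ^ (n - 2))) * 1 * (1 + \<rho>) ^ 0)"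
      by (simp add: power_mult_distrib)
    also have "l\<^sup>2 * l ^ (n - 2) = l ^ n" using n by (intro split) simp
    also have "c * D\<^sup>2 * (q\<^sup>2 * (\<kappa>\<^sup>2 * l ^ n) * 1 * (1 + \<rho>) ^ 0) \<le> c * D\<^sup>2 * E"
      using c D by (intro mult_left_mono E) auto
    finally show ?thesis .
  qed

  have third: "deriv_form 3 V (a + b) z + deriv_form 3 V (a - b) z \<le> 12 * (c * D ^ 3 * E)"
  proof -
    have "norm a ^ 3 + 3 * norm a * (norm b)\<^sup>2 \<le> (sqrt q * s) ^ 3 + 3 * (sqrt q * s) * (s * \<rho>)\<^sup>2"
      using s \<rho> sq by (intro add_mono power_mono mult_mono) auto
    also have "\<dots> = sqrt q * s ^ 3 * (q + 3 * \<rho>\<^sup>2)"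
      using sq(3) by (simp add: power_mult_distrib algebra_simps power3_eq_cube power2_eq_square)
    also have "\<dots> \<le> sqrt q * s ^ 3 * (6 * (1 + \<rho>)\<^sup>2)"
    proof -
      have "q + 3 * \<rho>\<^sup>2 \<le> 6 * (1 + \<rho>)\<^sup>2"
        using q \<rho> by (simp add: power2_sum) (smt (verit) zero_le_power2)
      then show ?thesis using sq s by (intro mult_left_mono) auto
    qed
    also have "\<dots> = 6 * (q\<^sup>2 * (\<kappa>\<^sup>2 * l ^ 3) * \<kappa> * (1 + \<rho>)\<^sup>2)"
    proof -
      have "sqrt q * sqrt q ^ 3 = q\<^sup>2" using sq(4) by (simp add: numeral_eq_Suc)
      then show ?thesis by (simp add: s_def power_mult_distrib power2_eq_square power3_eq_cube mult_ac)
    qed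
    finally have ab: "norm a ^ 3 + 3 * norm a * (norm b)\<^sup>2 \<le> 6 * (q\<^sup>2 * (\<kappa>\<^sup>2 * l ^ 3) * \<kappa> * (1 + \<rho>)\<^sup>2)" .
    have "deriv_form 3 V (a + b) z + deriv_form 3 V (a - b) z
       \<le> D ^ 3 * (2 * (norm a ^ 3 + 3 * norm a * (norm b)\<^sup>2) * (c * l ^ (n - 3)))"
      using abs_deriv_form_3_symmetrised_le[where a = a and b = b and x = z, OF word[of _ 3]] unfolding D_def l_def by simp
    also have "\<dots> \<le> D ^ 3 * (2 * (6 * (q\<^sup>2 * (\<kappa>\<^sup>2 * l ^ 3) * \<kappa> * (1 + \<rho>)\<^sup>2)) * (c * l ^ (n - 3)))"
      using D c l by (intro mult_left_mono mult_right_mono ab) auto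
    also have "\<dots> = 12 * (c * D ^ 3 * (q\<^sup>2 * (\<kappa>\<^sup>2 * (l ^ 3 * l ^ (n - 3))) * \<kappa> * (1 + \<rho>)\<^sup>2))"
      by (simp add: mult_ac)
    also have "l ^ 3 * l ^ (n - 3) = l ^ n" using n by (intro split) simp
    also have "12 * (c * D ^ 3 * (q\<^sup>2 * (\<kappa>\<^sup>2 * l ^ n) * \<kappa> * (1 + \<rho>)\<^sup>2)) \<le> 12 * (c * D ^ 3 * E)"
      using c D \<kappa> n by (intro mult_left_mono E) auto
    finally show ?thesis .
  qed

  have fourth: "deriv_form 4 V h (z + t *\<^sub>R h) \<le> c * D ^ 4 * (1 + c * D) ^ (n - 4) * E"
    if h: "norm h \<le> norm a + norm b" and t: "0 < t" "t < 1" for h t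
  proof -
    have "norm h \<le> s + s * \<rho>" using h s by linarith
    then have hs: "norm h \<le> s * (1 + \<rho>)" by (simp add: algebra_simps)
    also have "\<dots> \<le> l * (1 + \<rho>)" using s \<rho> by (intro mult_right_mono) auto
    finally have hl: "norm h \<le> l * (1 + \<rho>)" .
    have "t * norm h \<le> 1 * norm h" using t by (intro mult_right_mono) auto
    have "level n V (z + t *\<^sub>R h) \<le> l + c * D * norm (t *\<^sub>R h)"
      unfolding l_def D_def by (rule level_lipschitz[OF V])
    also have "\<dots> \<le> l * (1 + \<rho>) + c * D * (l * (1 + \<rho>))"
    proof (intro add_mono mult_left_mono)
      show "l \<le> l * (1 + \<rho>)" using l \<rho> by (simp add: algebra_simps)
      show "norm (t *\<^sub>R h) \<le> l * (1 + \<rho>)" using \<open>t * norm h \<le> 1 * norm h\<close> hl t by simp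
    qed (use c D in auto)
    also have "\<dots> = (1 + c * D) * l * (1 + \<rho>)" by (simp add: algebra_simps)
    finally have lev: "level n V (z + t *\<^sub>R h) \<le> (1 + c * D) * l * (1 + \<rho>)" .
    have lev0: "0 \<le> level n V (z + t *\<^sub>R h)" by (simp add: level_def)
    have "deriv_form 4 V h (z + t *\<^sub>R h) \<le> (D * norm h) ^ 4 * (c * level n V (z + t *\<^sub>R h) ^ (n - 4))"
      using abs_deriv_form_le[OF word, of 4 4 h "z + t *\<^sub>R h"] unfolding D_def by simp
    also have "\<dots> \<le> (D * (s * (1 + \<rho>))) ^ 4 * (c * ((1 + c * D) * l * (1 + \<rho>)) ^ (n - 4))"
      using D c hs lev lev0 s \<rho> by (intro mult_mono power_mono mult_left_mono) auto
    also have "\<dots> = c * D ^ 4 * (1 + c * D) ^ (n - 4) *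
        (q\<^sup>2 * (\<kappa>\<^sup>2 * (l ^ 4 * l ^ (n - 4))) * \<kappa>\<^sup>2 * ((1 + \<rho>) ^ 4 * (1 + \<rho>) ^ (n - 4)))"
    proof -
      have "\<kappa> ^ 4 = \<kappa>\<^sup>2 * \<kappa>\<^sup>2" by (simp flip: power_add)
      then show ?thesis by (simp add: s_def power_mult_distrib sq(4) mult_ac)
    qed
    also have "l ^ 4 * l ^ (n - 4) = l ^ n" using n by (intro split) simp
    also have "(1 + \<rho>) ^ 4 * (1 + \<rho>) ^ (n - 4) = (1 + \<rho>) ^ n" using n by (intro split) simp
    also have "c * D ^ 4 * (1 + c * D) ^ (n - 4) * (q\<^sup>2 * (\<kappa>\<^sup>2 * l ^ n) * \<kappa>\<^sup>2 * (1 + \<rho>) ^ n)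
       \<le> c * D ^ 4 * (1 + c * D) ^ (n - 4) * E"
      using c D \<kappa> by (intro mult_left_mono E) (auto simp: power_le_one)
    finally show ?thesis .
  qed

  have taylor: "V (z + h) \<le> V z + gradient V z \<bullet> h + deriv_form 2 V h z / 2 + deriv_form 3 V h z / 6
      + c * D ^ 4 * (1 + c * D) ^ (n - 4) * E / 24"
    if h: "norm h \<le> norm a + norm b" for h
  proof -
    obtain t where "0 < t" "t < 1" and t: "V (z + h) = (\<Sum>m<4. deriv_form m V h z / fact m) + deriv_form 4 V h (z + t *\<^sub>R h) / fact 4"
      using taylor_deriv_form[OF diff, of z h] by auto
    have "(\<Sum>m<4. deriv_form m V h z / fact m) = V z + gradient V z \<bullet> h + deriv_form 2 V h z / 2 + deriv_form 3 V h z / 6"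
      unfolding deriv_form_1[symmetric]
      by (simp add: lessThan_nat_numeral lessThan_Suc numeral_2_eq_2 numeral_3_eq_3 fact_numeral eval_nat_numeral del: deriv_form.simps(2))
    with t fourth[OF h \<open>0 < t\<close> \<open>t < 1\<close>] show ?thesis by (simp add: fact_numeral)
  qed
  have average: "x + y \<le> 2 * (v + ga + v2 / 2) + u2 + (r + s) / 6 + e / 12"
    if "x \<le> v + g + p / 2 + r / 6 + e / 24" "y \<le> v + g' + p' / 2 + s / 6 + e / 24"
      "p + p' = 2 * u2 + 2 * v2" "g = ga + gb" "g' = ga - gb"
    for x y v g g' ga gb p p' u2 v2 r s e :: real
    using that by (simp add: field_simps)
  have "V (z + (a + b)) + V (z + (a - b)) \<le> 2 * (V z + gradient V z \<bullet> a + deriv_form 2 V b z / 2)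
      + deriv_form 2 V a z + (deriv_form 3 V (a + b) z + deriv_form 3 V (a - b) z) / 6
      + c * D ^ 4 * (1 + c * D) ^ (n - 4) * E / 12"
    by (rule average[OF taylor[OF norm_triangle_ineq] taylor[OF norm_triangle_ineq4]
          deriv_form_2_parallelogram inner_add_right inner_diff_right])
  also have "\<dots> \<le> 2 * (V z + gradient V z \<bullet> a + deriv_form 2 V b z / 2)
     + c * D\<^sup>2 * E + 2 * (c * D ^ 3 * E) + c * D ^ 4 * (1 + c * D) ^ (n - 4) * E / 12"
    using third by (intro add_mono second order_refl) simp
  also have "\<dots> \<le> 2 * (V z + gradient V z \<bullet> a + deriv_form 2 V b z / 2 + (c * D\<^sup>2 * E + c * D ^ 3 * E + c * D ^ 4 * (1 + c * D) ^ (n - 4) * E))"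
  proof -
    have "0 \<le> c * D\<^sup>2 * E" "0 \<le> c * D ^ 4 * (1 + c * D) ^ (n - 4) * E"
      using c D E0 by auto
    then show ?thesis by (simp add: algebra_simps)
  qed
  also have "c * D\<^sup>2 * E + c * D ^ 3 * E + c * D ^ 4 * (1 + c * D) ^ (n - 4) * E = taylor_const CARD('d) n c * E"
    by (simp add: taylor_const_def D_def algebra_simps)
  finally show ?thesis by (simp add: E_def l_def)
qed

section \<open>Expected decrease in one truncated step\<close>

lemma norm_matrix_vector_mult_le:
  fixes A :: "real^'m::finite^'d::finite"
  shows "norm (A *v x) \<le> norm A * norm x"
proof -
  have "norm (A *v x) = L2_set (\<lambda>i. norm (A $ i \<bullet> x)) UNIV"
    by (simp add: norm_vec_def matrix_mult_dot)
  also have "\<dots> \<le> L2_set (\<lambda>i. norm (A $ i) * norm x) UNIV"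
    by (intro L2_set_mono) (auto simp: Cauchy_Schwarz_ineq2)
  also have "\<dots> = norm A * norm x"
    by (simp add: L2_set_left_distrib norm_vec_def[of A])
  finally show ?thesis .
qed

lemma one_plus_sum_le_prod:
  fixes u :: "'i \<Rightarrow> real"
  assumes "finite I" "\<And>i. 0 \<le> u i"
  shows "1 + (\<Sum>i\<in>I. u i) \<le> (\<Prod>i\<in>I. 1 + u i)"
  using assms(1)
proof induction
  case (insert i I)
  have "1 + (\<Sum>i\<in>insert i I. u i) \<le> (1 + u i) * (1 + (\<Sum>i\<in>I. u i))"
    using insert assms(2) by (simp add: algebra_simps sum_nonneg)
  also have "\<dots> \<le> (1 + u i) * (\<Prod>i\<in>I. 1 + u i)"
    using insert assms(2)[of i] by (intro mult_left_mono) auto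
  finally show ?case using insert by simp
qed simp

text \<open>Replaces the norm by a product over the coordinates, whose Gaussian integral factorises.\<close>

lemma one_plus_norm_power_le_prod:
  fixes x :: "real^'m::finite"
  assumes "\<sigma> > 0"
  shows "(1 + norm x / \<sigma>) ^ n \<le> (\<Prod>i\<in>UNIV. (1 + \<bar>x $ i\<bar> / \<sigma>) ^ n)"
proof -
  have "1 + norm x / \<sigma> \<le> 1 + (\<Sum>i\<in>UNIV. \<bar>x $ i\<bar> / \<sigma>)"
    using norm_le_l1_cart[of x] assms by (simp add: sum_divide_distrib[symmetric] divide_right_mono)
  also have "\<dots> \<le> (\<Prod>i\<in>UNIV. 1 + \<bar>x $ i\<bar> / \<sigma>)"
    using assms by (intro one_plus_sum_le_prod) auto
  finally show ?thesis
    using assms unfolding prod_power_distrib[symmetric] by (intro power_mono) auto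
qed

lemma truncation_scale:
  assumes "R > 0"
  shows "\<exists>\<epsilon>. 0 < \<epsilon> \<and> \<epsilon> \<le> 1 \<and> truncation R x = \<epsilon> *\<^sub>R x"
proof (cases "x = 0")
  case True
  then show ?thesis by (intro exI[of _ 1]) (simp add: truncation_def)
next
  case False
  then show ?thesis using assms
    by (intro exI[of _ "min (norm x) R / norm x"] conjI) (simp_all add: divide_le_eq, simp add: truncation_def divide_inverse)
qed

lemma norm_truncation_le: "R \<ge> 0 \<Longrightarrow> norm (truncation R x) \<le> R"
  by (cases "x = 0") (auto simp: truncation_def field_simps)

lemma truncation_measurable[measurable]: "truncation R \<in> borel_measurable borel"
  unfolding truncation_def by measurable

text \<open>A power because the dominating product of the coordinates factorises under the integral.\<close>

definition gauss_const :: "nat \<Rightarrow> nat \<Rightarrow> real" where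
  "gauss_const m n = (\<integral>x. std_normal_density x * (1 + \<bar>x\<bar>) ^ n \<partial>lborel) ^ m"

lemma
  assumes \<sigma>: "\<sigma> > 0"
  shows integrable_gauss_prod_power: "integrable (gauss \<sigma>) (\<lambda>x::real^'m::finite. \<Prod>i\<in>UNIV. (1 + \<bar>x $ i\<bar> / \<sigma>) ^ n)"
    and integral_gauss_prod_power:
      "(\<integral>x. (\<Prod>i\<in>UNIV. (1 + \<bar>x $ i\<bar> / \<sigma>) ^ n) \<partial>(gauss \<sigma> :: (real^'m) measure)) = gauss_const CARD('m) n"
proof -
  have int: "integrable lborel (\<lambda>x. normal_density 0 \<sigma> x * (1 + \<bar>x\<bar> / \<sigma>) ^ n)"
    by (rule integrable_normal_one_plus_abs[OF \<sigma>])
  have m: "(\<lambda>x. (1 + \<bar>x\<bar> / \<sigma>) ^ n) \<in> borel_measurable borel" by measurable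
  show "integrable (gauss \<sigma>) (\<lambda>x::real^'m::finite. \<Prod>i\<in>UNIV. (1 + \<bar>x $ i\<bar> / \<sigma>) ^ n)"
    by (rule integrable_gauss_prod[where h = "\<lambda>i x. (1 + \<bar>x\<bar> / \<sigma>) ^ n", OF int m])
  show "(\<integral>x. (\<Prod>i\<in>UNIV. (1 + \<bar>x $ i\<bar> / \<sigma>) ^ n) \<partial>(gauss \<sigma> :: (real^'m) measure)) = gauss_const CARD('m) n"
    by (subst integral_gauss_prod[where h = "\<lambda>i x. (1 + \<bar>x\<bar> / \<sigma>) ^ n", OF int m])
      (simp add: integral_normal_one_plus_abs[OF \<sigma>] gauss_const_def)
qed

lemma trace_hessian_form:
  fixes G :: "real^'m::finite^'d::finite"
  shows "trace (transpose G ** hessian V z ** G)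
    = (\<Sum>i\<in>UNIV. \<Sum>j\<in>UNIV. \<Sum>k\<in>UNIV. G $ i $ k * G $ j $ k * partial_deriv j (partial_deriv i V) z)"
proof -
  have "trace (transpose G ** hessian V z ** G)
    = (\<Sum>k\<in>UNIV. \<Sum>i\<in>UNIV. \<Sum>j\<in>UNIV. G $ i $ k * G $ j $ k * partial_deriv j (partial_deriv i V) z)"
    by (simp add: trace_def matrix_matrix_mult_def transpose_def hessian_def sum_distrib_right sum_distrib_left mult_ac)
  also have "\<dots> = (\<Sum>i\<in>UNIV. \<Sum>k\<in>UNIV. \<Sum>j\<in>UNIV. G $ i $ k * G $ j $ k * partial_deriv j (partial_deriv i V) z)"
    by (rule sum.swap)
  also have "\<dots> = (\<Sum>i\<in>UNIV. \<Sum>j\<in>UNIV. \<Sum>k\<in>UNIV. G $ i $ k * G $ j $ k * partial_deriv j (partial_deriv i V) z)"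
    by (intro sum.cong refl sum.swap)
  finally show ?thesis .
qed

lemma
  fixes G :: "real^'m::finite^'d::finite"
  assumes \<sigma>: "\<sigma> > 0"
  shows integrable_gauss_deriv_form_2: "integrable (gauss \<sigma>) (\<lambda>x. deriv_form 2 V (G *v x) z)"
    and integral_gauss_deriv_form_2:
      "(\<integral>x. deriv_form 2 V (G *v x) z \<partial>gauss \<sigma>) = \<sigma>\<^sup>2 * trace (transpose G ** hessian V z ** G)"
proof -
  let ?c = "\<lambda>i j k l. G $ i $ k * G $ j $ l * partial_deriv j (partial_deriv i V) z"
  have eq: "deriv_form 2 V (G *v x) z
     = (\<Sum>i\<in>UNIV. \<Sum>j\<in>UNIV. \<Sum>k\<in>UNIV. \<Sum>l\<in>UNIV. ?c i j k l * (x $ k * x $ l))" for x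
    unfolding deriv_form_2 matrix_vector_mult_def vec_lambda_beta sum_product sum_distrib_right
    by (intro sum.cong refl) (simp add: sum_distrib_left mult_ac)
  note int = integrable_gauss_mult[OF \<sigma>]
  show "integrable (gauss \<sigma>) (\<lambda>x. deriv_form 2 V (G *v x) z)"
    unfolding eq by (intro Bochner_Integration.integrable_sum integrable_mult_right int)
  have "(\<integral>x. deriv_form 2 V (G *v x) z \<partial>gauss \<sigma>)
     = (\<Sum>i\<in>UNIV. \<Sum>j\<in>UNIV. \<Sum>k\<in>UNIV. \<Sum>l\<in>UNIV. ?c i j k l * (if k = l then \<sigma>\<^sup>2 else 0))"
    unfolding eq
    by (simp add: Bochner_Integration.integral_sum Bochner_Integration.integrable_sum integrable_mult_right int integral_gauss_mult[OF \<sigma>])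
  also have "\<dots> = (\<Sum>i\<in>UNIV. \<Sum>j\<in>UNIV. \<Sum>k\<in>UNIV. ?c i j k k * \<sigma>\<^sup>2)"
    by (simp add: if_distrib cong: if_cong)
  also have "\<dots> = \<sigma>\<^sup>2 * trace (transpose G ** hessian V z ** G)"
    unfolding trace_hessian_form by (simp add: sum_distrib_left mult_ac)
  finally show "(\<integral>x. deriv_form 2 V (G *v x) z \<partial>gauss \<sigma>) = \<sigma>\<^sup>2 * trace (transpose G ** hessian V z ** G)" .
qed

lemma continuous_bounded_on_ball:
  fixes u :: "'a::heine_borel \<Rightarrow> real" and a :: 'a
  assumes "continuous_on UNIV u"
  obtains C where "\<And>x. dist a x \<le> R \<Longrightarrow> \<bar>u x\<bar> \<le> C"
proof -
  have "compact (u ` cball a R)"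
    by (intro compact_continuous_image continuous_on_subset[OF assms]) auto
  then obtain C where "\<forall>y\<in>u ` cball a R. \<bar>y\<bar> \<le> C"
    by (auto dest!: compact_imp_bounded simp: bounded_iff)
  then show thesis by (intro that[of C]) auto
qed

text \<open>The bounds \<open>f\<close> and \<open>g\<close> are those encoded in \<open>\<phi>\<close>, with \<open>P = \<phi> R\<close>. The point \<open>z\<close> is fixed, and the
constant in front of the error depends on neither \<open>z\<close>, \<open>R\<close> nor \<open>\<Delta>\<close>, so that one threshold for
\<open>\<Delta>\<close> serves the whole ball although its radius grows as \<open>\<Delta>\<close> shrinks.\<close>

lemma one_step_drift:
  fixes V :: "real^'d::finite \<Rightarrow> real" and f :: "real^'d \<Rightarrow> real^'d" and g :: "real^'d \<Rightarrow> real^'m::finite^'d"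
  assumes V: "derivs_bounded n c V"
    and scale: "\<And>x \<epsilon>. 0 < \<epsilon> \<Longrightarrow> \<epsilon> \<le> 1 \<Longrightarrow> V (\<epsilon> *\<^sub>R x) \<le> V x"
    and R: "R > 0" and \<Delta>: "\<Delta> > 0" and P: "0 \<le> P" "\<Delta> * P \<le> 1"
    and m: "0 \<le> m" "m \<le> V z"
    and f: "(1 + V z) powr (1/2 - 1 / real n) * norm (f z) \<le> P * sqrt m"
    and g: "(1 + V z) powr (1 - 2 * (1 / real n)) * (norm (g z))\<^sup>2 \<le> P * m"
  shows "(\<integral>\<xi>. V (truncation R (z + \<Delta> *\<^sub>R f z + g z *v \<xi>)) \<partial>gauss (sqrt \<Delta>))
    \<le> V z + \<Delta> * generator f g V z + taylor_const CARD('d) n c * gauss_const CARD('m) n * ((\<Delta> * P)\<^sup>2 * m)"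
proof -
  have nn: "0 \<le> V x" for x using V by (auto simp: derivs_bounded_def)
  have n: "4 \<le> n" and contV: "continuous_on UNIV V"
    using V cont_diff_imp_continuous unfolding derivs_bounded_def by blast+
  define \<sigma> where "\<sigma> = sqrt \<Delta>"
  have \<sigma>: "\<sigma> > 0" "\<sigma>\<^sup>2 = \<Delta>" using \<Delta> by (auto simp: \<sigma>_def)
  interpret G: prob_space "gauss \<sigma> :: (real^'m) measure" by (rule prob_space_gauss[OF \<sigma>(1)])
  have [measurable]: "V \<in> borel_measurable borel" by (rule borel_measurable_continuous_onI[OF contV])
  define L where "L = 1 + V z"
  have L: "1 \<le> L" using nn[of z] by (simp add: L_def)
  define l where "l = level n V z"
  have l: "l = L powr (1 / real n)" "1 \<le> l" unfolding l_def using level_ge_1[of V z n] nn by (auto simp: level_def L_def)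
  have ln: "l ^ n = L" using level_power[of V z 0 n] nn n L by (simp add: l_def L_def)
  define \<kappa> where "\<kappa> = sqrt (m / L)"
  have \<kappa>: "0 \<le> \<kappa>" "\<kappa> \<le> 1" "\<kappa>\<^sup>2 * L = m"
    using m L by (auto simp: \<kappa>_def L_def)
  have root: "L powr (1/2 - 1 / real n) * (\<kappa> * l) = sqrt m"
  proof -
    have "L powr (1/2 - 1 / real n) * (\<kappa> * l) = \<kappa> * (L powr (1/2 - 1 / real n) * L powr (1 / real n))"
      by (simp add: l)
    also have "L powr (1/2 - 1 / real n) * L powr (1 / real n) = sqrt L"
      using L by (simp add: powr_add[symmetric] powr_half_sqrt)
    also have "\<kappa> * sqrt L = sqrt m" using L by (simp add: \<kappa>_def real_sqrt_divide)
    finally show ?thesis .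
  qed
  define p where "p = L powr (1/2 - 1 / real n)"
  have p: "p > 0" "p * p = L powr (1 - 2 * (1 / real n))"
    using L by (auto simp: p_def powr_add[symmetric])
  define q where "q = \<Delta> * P"
  have q: "0 \<le> q" "q \<le> 1" using P \<Delta> by (auto simp: q_def)
  define a where "a = \<Delta> *\<^sub>R f z"
  have fz: "norm (f z) \<le> P * (\<kappa> * l)"
  proof -
    have "p * norm (f z) \<le> p * (P * (\<kappa> * l))" using f root by (simp add: L_def p_def mult_ac)
    then show ?thesis using p by simp
  qed
  have gz: "norm (g z) \<le> sqrt P * (\<kappa> * l)"
  proof -
    have "(p * norm (g z))\<^sup>2 = (p * p) * (norm (g z))\<^sup>2" by (simp add: power2_eq_square)
    then have "(p * norm (g z))\<^sup>2 \<le> P * m" using g p(2) by (simp add: L_def)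
    then have "p * norm (g z) \<le> sqrt (P * m)" by (rule real_le_rsqrt)
    also have "\<dots> = p * (sqrt P * (\<kappa> * l))" using root by (simp add: p_def real_sqrt_mult mult_ac)
    finally show ?thesis using p by simp
  qed
  have a: "norm a \<le> q * (\<kappa> * l)"
    using fz \<Delta> by (simp add: a_def q_def mult.assoc)
  have b: "norm (g z *v \<xi>) \<le> sqrt q * (\<kappa> * l) * (norm \<xi> / \<sigma>)" for \<xi>
  proof -
    have "norm (g z *v \<xi>) \<le> norm (g z) * norm \<xi>" by (rule norm_matrix_vector_mult_le)
    also have "\<dots> \<le> sqrt P * (\<kappa> * l) * norm \<xi>" by (intro mult_right_mono gz) auto
    also have "\<dots> = sqrt q * (\<kappa> * l) * (norm \<xi> / \<sigma>)"
      using \<sigma>(1) \<Delta> by (simp add: q_def real_sqrt_mult \<sigma>_def)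
    finally show ?thesis .
  qed
  have Vt: "V (truncation R x) \<le> V x" for x
    using truncation_scale[OF R, of x] scale by metis
  define H where "H \<xi> = V (truncation R (z + \<Delta> *\<^sub>R f z + g z *v \<xi>))" for \<xi>
  have [measurable]: "(\<lambda>\<xi>. g z *v \<xi>) \<in> borel_measurable borel"
    by (intro borel_measurable_continuous_onI linear_continuous_on) (simp add: matrix_vector_mul_bounded_linear)
  have Hm[measurable]: "H \<in> borel_measurable borel" unfolding H_def by measurable
  obtain C where "\<And>x. dist 0 x \<le> R \<Longrightarrow> \<bar>V x\<bar> \<le> C"
    using continuous_bounded_on_ball[OF contV, of 0 R] by blast
  then have C: "\<bar>V (truncation R x)\<bar> \<le> C" for x using norm_truncation_le[of R x] R by simp
  have Hi: "integrable (gauss \<sigma>) H"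
    by (rule G.integrable_const_bound[of _ C]) (auto simp: H_def C)
  define T where "T = taylor_const CARD('d) n c"
  have T: "0 \<le> T" using V by (auto simp: T_def taylor_const_def derivs_bounded_def)
  \<comment> \<open>Only after averaging over \<open>\<xi>\<close> and \<open>-\<xi>\<close> does a pointwise bound without odd terms hold.\<close>
  have pt: "(H \<xi> + H (- \<xi>)) / 2 \<le> V z + \<Delta> * (gradient V z \<bullet> f z) + deriv_form 2 V (g z *v \<xi>) z / 2
      + T * (q\<^sup>2 * m) * (\<Prod>i\<in>UNIV. (1 + \<bar>\<xi> $ i\<bar> / \<sigma>) ^ n)" for \<xi>
  proof -
    have "H \<xi> \<le> V (z + (a + g z *v \<xi>))" "H (- \<xi>) \<le> V (z + (a - g z *v \<xi>))"
      using Vt[of "z + (a + g z *v \<xi>)"] Vt[of "z + (a - g z *v \<xi>)"]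
      by (simp_all add: H_def a_def algebra_simps linear_neg[OF matrix_vector_mul_linear])
    then have "(H \<xi> + H (- \<xi>)) / 2 \<le> (V (z + (a + g z *v \<xi>)) + V (z + (a - g z *v \<xi>))) / 2"
      by (intro divide_right_mono add_mono) auto
    also have "\<dots> \<le> V z + gradient V z \<bullet> a + deriv_form 2 V (g z *v \<xi>) z / 2
      + T * (q\<^sup>2 * (\<kappa>\<^sup>2 * level n V z ^ n) * (1 + norm \<xi> / \<sigma>) ^ n)"
      unfolding T_def using \<sigma>(1) q \<kappa> a b
      by (intro symmetrised_taylor_bound[OF V, where \<kappa> = \<kappa>]) (auto simp: l_def)
    also have "\<kappa>\<^sup>2 * level n V z ^ n = m" using \<kappa> ln by (simp add: l_def)
    also have "T * (q\<^sup>2 * m * (1 + norm \<xi> / \<sigma>) ^ n) \<le> T * (q\<^sup>2 * m * (\<Prod>i\<in>UNIV. (1 + \<bar>\<xi> $ i\<bar> / \<sigma>) ^ n))"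
      using T m by (intro mult_left_mono one_plus_norm_power_le_prod \<sigma>) auto
    finally show ?thesis by (simp add: a_def mult_ac)
  qed
  have Hs: "integrable (gauss \<sigma>) (\<lambda>\<xi>. H (- \<xi>))" "(\<integral>\<xi>. H (- \<xi>) \<partial>gauss \<sigma>) = (\<integral>\<xi>. H \<xi> \<partial>gauss \<sigma>)"
    using integral_gauss_uminus[OF Hm] Hi by auto
  have "(\<integral>\<xi>. H \<xi> \<partial>gauss \<sigma>) = (\<integral>\<xi>. (H \<xi> + H (- \<xi>)) / 2 \<partial>gauss \<sigma>)"
    using Hi Hs by simp
  also have "\<dots> \<le> (\<integral>\<xi>. V z + \<Delta> * (gradient V z \<bullet> f z) + deriv_form 2 V (g z *v \<xi>) z / 2
      + T * (q\<^sup>2 * m) * (\<Prod>i\<in>UNIV. (1 + \<bar>\<xi> $ i\<bar> / \<sigma>) ^ n) \<partial>gauss \<sigma>)"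
    using Hi Hs pt
    by (intro integral_mono) (auto intro!: integrable_gauss_deriv_form_2 integrable_gauss_prod_power \<sigma>
         Bochner_Integration.integrable_add integrable_mult_right)
  also have "\<dots> = V z + \<Delta> * (gradient V z \<bullet> f z) + (\<Delta> * trace (transpose (g z) ** hessian V z ** g z)) / 2
      + T * (q\<^sup>2 * m) * gauss_const CARD('m) n"
    using \<sigma> integrable_gauss_deriv_form_2[OF \<sigma>(1), of V "g z" z] integrable_gauss_prod_power[OF \<sigma>(1), of n, where 'm = 'm]
    by (simp add: integral_gauss_deriv_form_2 integral_gauss_prod_power G.prob_space[simplified])
  finally show ?thesis
    unfolding H_def \<sigma>_def[symmetric] by (simp add: T_def q_def generator_def algebra_simps)
qed

section \<open>Convergence of the scheme\<close>

text \<open>The extended quotient \<open>a / 0\<close> is infinite unless \<open>a = 0\<close>, so the bound also holds when \<open>b = 0\<close>.\<close>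

lemma le_of_ennreal_divide_le:
  assumes "ennreal a / ennreal b \<le> ennreal P" "0 \<le> a" "0 \<le> b" "0 \<le> P"
  shows "a \<le> P * b"
proof (cases "b = 0")
  case True
  then show ?thesis using assms by (cases "a = 0") (auto simp: ennreal_eq_0_iff top_unique)
next
  case False
  then have "ennreal (a / b) \<le> ennreal P" using assms by (simp add: divide_ennreal)
  then have "a / b \<le> P" using assms by (simp add: ennreal_le_iff)
  then show ?thesis using assms False by (simp add: field_simps)
qed

text \<open>On the compact set of those points in the closure of the sequence whose distance from the zero set
is at least \<open>e\<close>, \<open>w\<close> has a positive minimum.\<close>

lemma tendsto_infdist_zero_set:
  fixes w :: "'a::heine_borel \<Rightarrow> real"
  assumes w: "continuous_on UNIV w" "\<And>x. 0 \<le> w x"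
    and z: "bounded (range z)" and lim: "(\<lambda>k. w (z k)) \<longlonglongrightarrow> 0"
  shows "(\<lambda>k. infdist (z k) {x. w x = 0}) \<longlonglongrightarrow> 0"
proof (rule LIMSEQ_I)
  fix e :: real assume e: "e > 0"
  define A where "A = closure (range z) \<inter> {x. e \<le> infdist x {x. w x = 0}}"
  have A: "compact A" unfolding A_def
    by (intro compact_Int_closed closed_Collect_le continuous_intros) (use z in \<open>simp add: compact_closure\<close>)
  have zA: "z k \<in> A \<longleftrightarrow> e \<le> infdist (z k) {x. w x = 0}" for k
    using closure_subset[of "range z"] by (auto simp: A_def)
  have "\<forall>\<^sub>F k in sequentially. z k \<notin> A"
  proof (cases "A = {}")
    case False
    then obtain y where y: "y \<in> A" "\<And>x. x \<in> A \<Longrightarrow> w y \<le> w x"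
      using continuous_attains_inf[OF A False continuous_on_subset[OF w(1)]] by auto
    have "w y \<noteq> 0" using y(1) e by (auto simp: A_def)
    then have "w y > 0" using w(2)[of y] by simp
    from order_tendstoD(2)[OF lim this] show ?thesis
      by eventually_elim (use y(2) in force)
  qed simp
  then show "\<exists>N. \<forall>k\<ge>N. norm (infdist (z k) {x. w x = 0} - 0) < e"
    by (simp add: eventually_sequentially zA not_le infdist_nonneg)
qed

lemma small_step_powr:
  fixes \<Delta> :: real
  assumes "0 < \<Delta>" "\<Delta> \<le> A powr (1 / a)" "0 < A" "0 < a"
  shows "\<Delta> powr a \<le> A"
proof -
  have "\<Delta> powr a \<le> (A powr (1 / a)) powr a"
    using assms by (intro powr_mono2) auto
  then show ?thesis using assms by (simp add: powr_powr)
qed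

context prob_space
begin

text \<open>The joint law of \<open>Z\<close> and the increment is a product measure; Fubini then integrates out the
increment with \<open>Z\<close> frozen.\<close>

lemma expectation_independent_increment:
  fixes Z :: "'a \<Rightarrow> 'b::euclidean_space" and X :: "'a \<Rightarrow> real^'m::finite"
  assumes N: "subalgebra M N" and Z: "Z \<in> borel_measurable N"
    and indep: "indep_set (sets (vimage_algebra (space M) X borel)) (sets N)"
    and dist: "distributed M lborel X (\<lambda>x. ennreal (\<Prod>i\<in>UNIV. normal_density 0 \<sigma> (x $ i)))"
    and H[measurable]: "(\<lambda>(z, \<xi>). H z \<xi>) \<in> borel_measurable (borel \<Otimes>\<^sub>M borel)"
    and bnd: "\<And>z \<xi>. \<bar>H z \<xi>\<bar> \<le> (C::real)"
  shows "expectation (\<lambda>\<omega>. H (Z \<omega>) (X \<omega>)) = expectation (\<lambda>\<omega>. \<integral>\<xi>. H (Z \<omega>) \<xi> \<partial>gauss \<sigma>)"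
    and "(\<lambda>z. \<integral>\<xi>. H z \<xi> \<partial>gauss \<sigma>) \<in> borel_measurable borel"
proof -
  have Zm[measurable]: "Z \<in> borel_measurable M" by (rule measurable_from_subalg[OF N Z])
  have Xm[measurable]: "X \<in> borel_measurable M" using distributed_measurable[OF dist] by simp
  have dX: "distr M borel X = gauss \<sigma>"
  proof -
    have "distr M borel X = distr M lborel X" by (rule distr_cong) auto
    then show ?thesis using distributed_distr_eq_density[OF dist] by (simp add: gauss_def)
  qed
  have prob: "prob (Z -` A \<inter> space M \<inter> (X -` A' \<inter> space M)) = prob (Z -` A \<inter> space M) * prob (X -` A' \<inter> space M)"
    if "A \<in> sets borel" "A' \<in> sets borel" for A A'
  proof -
    have "X -` A' \<inter> space M \<in> sets (vimage_algebra (space M) X borel)"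
      using that by (intro in_vimage_algebra)
    moreover have "Z -` A \<inter> space M \<in> sets N"
      using measurable_sets[OF Z that(1)] N by (simp add: subalgebra_def)
    ultimately have "prob (X -` A' \<inter> space M \<inter> (Z -` A \<inter> space M)) = prob (X -` A' \<inter> space M) * prob (Z -` A \<inter> space M)"
      using indep unfolding indep_sets2_eq by blast
    then show ?thesis by (simp add: Int_commute mult.commute)
  qed
  interpret Z: prob_space "distr M borel Z" by (rule prob_space_distr) measurable
  interpret X: prob_space "gauss \<sigma> :: (real^'m) measure"
    unfolding dX[symmetric] by (rule prob_space_distr) measurable
  interpret ZX: pair_prob_space "distr M borel Z" "gauss \<sigma> :: (real^'m) measure" ..
  have joint: "distr M borel Z \<Otimes>\<^sub>M gauss \<sigma> = distr M (borel \<Otimes>\<^sub>M borel) (\<lambda>\<omega>. (Z \<omega>, X \<omega>))"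
  proof (rule pair_measure_eqI)
    show "sigma_finite_measure (distr M borel Z)" "sigma_finite_measure (gauss \<sigma> :: (real^'m) measure)" ..
    fix A and A' :: "(real^'m) set" assume A: "A \<in> sets (distr M borel Z)" "A' \<in> sets (gauss \<sigma>)"
    have "emeasure (distr M (borel \<Otimes>\<^sub>M borel) (\<lambda>\<omega>. (Z \<omega>, X \<omega>))) (A \<times> A')
        = emeasure M ((\<lambda>\<omega>. (Z \<omega>, X \<omega>)) -` (A \<times> A') \<inter> space M)"
      using A by (intro emeasure_distr) auto
    also have "(\<lambda>\<omega>. (Z \<omega>, X \<omega>)) -` (A \<times> A') \<inter> space M = Z -` A \<inter> space M \<inter> (X -` A' \<inter> space M)"
      by auto
    also have "emeasure M \<dots> = emeasure M (Z -` A \<inter> space M) * emeasure M (X -` A' \<inter> space M)"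
      using A prob by (simp add: emeasure_eq_measure ennreal_mult)
    also have "\<dots> = emeasure (distr M borel Z) A * emeasure (gauss \<sigma>) A'"
      unfolding dX[symmetric] using A by (simp add: emeasure_distr)
    finally show "emeasure (distr M borel Z) A * emeasure (gauss \<sigma>) A'
        = emeasure (distr M (borel \<Otimes>\<^sub>M borel) (\<lambda>\<omega>. (Z \<omega>, X \<omega>))) (A \<times> A')" ..
  qed (auto intro!: sets_pair_measure_cong)
  have setsZX: "sets (distr M borel Z \<Otimes>\<^sub>M (gauss \<sigma> :: (real^'m) measure)) = sets (borel \<Otimes>\<^sub>M borel)"
    by (intro sets_pair_measure_cong) auto
  have Hm: "(\<lambda>(z, \<xi>). H z \<xi>) \<in> borel_measurable (distr M borel Z \<Otimes>\<^sub>M gauss \<sigma>)"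
    using H by (simp add: measurable_cong_sets[OF setsZX refl])
  have int: "integrable (distr M borel Z \<Otimes>\<^sub>M gauss \<sigma>) (\<lambda>(z, \<xi>). H z \<xi>)"
    using Hm bnd by (intro ZX.integrable_const_bound[of _ C]) auto
  show m[measurable]: "(\<lambda>z. \<integral>\<xi>. H z \<xi> \<partial>gauss \<sigma>) \<in> borel_measurable borel"
  proof (rule X.borel_measurable_lebesgue_integral)
    have "sets (borel \<Otimes>\<^sub>M (gauss \<sigma> :: (real^'m) measure)) = sets (borel \<Otimes>\<^sub>M borel)"
      by (intro sets_pair_measure_cong) auto
    then show "(\<lambda>(z, \<xi>). H z \<xi>) \<in> borel_measurable (borel \<Otimes>\<^sub>M gauss \<sigma>)"
      using H measurable_cong_sets by blast
  qed
  have "expectation (\<lambda>\<omega>. H (Z \<omega>) (X \<omega>))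
     = (\<integral>p. (case p of (z, \<xi>) \<Rightarrow> H z \<xi>) \<partial>distr M (borel \<Otimes>\<^sub>M borel) (\<lambda>\<omega>. (Z \<omega>, X \<omega>)))"
    by (subst integral_distr) auto
  also have "\<dots> = (\<integral>z. (\<integral>\<xi>. H z \<xi> \<partial>gauss \<sigma>) \<partial>distr M borel Z)"
    unfolding joint[symmetric] using ZX.integral_fst'[OF int] by simp
  also have "\<dots> = expectation (\<lambda>\<omega>. \<integral>\<xi>. H (Z \<omega>) \<xi> \<partial>gauss \<sigma>)"
    by (rule integral_distr) measurable
  finally show "expectation (\<lambda>\<omega>. H (Z \<omega>) (X \<omega>)) = expectation (\<lambda>\<omega>. \<integral>\<xi>. H (Z \<omega>) \<xi> \<partial>gauss \<sigma>)" .
qed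

text \<open>Telescoping bounds the sum of the expectations of \<open>e k\<close> by \<open>v 0 / \<epsilon>\<close>, so the sum of the \<open>e k\<close> has finite
expectation and is almost surely finite.\<close>

lemma AE_tendsto_0_of_decreasing_expectation:
  fixes e :: "nat \<Rightarrow> 'a \<Rightarrow> real" and v :: "nat \<Rightarrow> real"
  assumes e: "\<And>k. integrable M (e k)" "\<And>k \<omega>. 0 \<le> e k \<omega>"
    and v: "\<And>k. 0 \<le> v k" "\<And>k. v (Suc k) \<le> v k - \<epsilon> * expectation (e k)" and \<epsilon>: "\<epsilon> > 0"
  shows "AE \<omega> in M. (\<lambda>k. e k \<omega>) \<longlonglongrightarrow> 0"
proof -
  have [measurable]: "e k \<in> borel_measurable M" for k using e(1) by auto
  have part: "(\<Sum>k<N. expectation (e k)) \<le> v 0 / \<epsilon>" for N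
  proof -
    have "v N + \<epsilon> * (\<Sum>k<N. expectation (e k)) \<le> v 0"
    proof (induction N)
      case (Suc N)
      then show ?case using v(2)[of N] by (simp add: algebra_simps)
    qed simp
    then have "\<epsilon> * (\<Sum>k<N. expectation (e k)) \<le> v 0" using v(1)[of N] by linarith
    then show ?thesis using \<epsilon> by (simp add: field_simps)
  qed
  have nn: "0 \<le> expectation (e k)" for k using e(2) by (intro integral_nonneg_AE) auto
  have "(\<integral>\<^sup>+\<omega>. (\<Sum>k. ennreal (e k \<omega>)) \<partial>M) = (\<Sum>k. \<integral>\<^sup>+\<omega>. ennreal (e k \<omega>) \<partial>M)"
    by (rule nn_integral_suminf) measurable
  also have "\<dots> = (\<Sum>k. ennreal (expectation (e k)))"
    using e by (intro suminf_cong nn_integral_eq_integral) auto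
  also have "\<dots> \<le> ennreal (v 0 / \<epsilon>)"
    using part nn by (intro suminf_le_const) (auto simp: sum_ennreal intro!: ennreal_leI)
  also have "\<dots> < \<infinity>" by simp
  finally have "AE \<omega> in M. (\<Sum>k. ennreal (e k \<omega>)) \<noteq> \<infinity>"
    by (intro nn_integral_PInf_AE) auto
  then show ?thesis
  proof eventually_elim
    case (elim \<omega>)
    then have "summable (\<lambda>k. e k \<omega>)" using e(2) by (intro summable_suminf_not_top) auto
    then show ?case by (rule summable_LIMSEQ_zero)
  qed
qed

end

lemma matrix_vector_mult_measurable:
  fixes A :: "'a \<Rightarrow> real^'m::finite^'d::finite"
  assumes "A \<in> borel_measurable M" "x \<in> borel_measurable M"
  shows "(\<lambda>\<omega>. A \<omega> *v x \<omega>) \<in> borel_measurable M"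
  using assms
  by (rule borel_measurable_continuous_Pair) (unfold matrix_vector_mult_def, intro continuous_intros)

lemma norm_truncated_EM_le:
  assumes "norm x0 \<le> R"
  shows "norm (truncated_EM f g x0 B R \<Delta> k \<omega>) \<le> R"
proof -
  have "0 \<le> R" using assms norm_ge_zero[of x0] by linarith
  then show ?thesis using assms by (cases k) (auto simp: Let_def norm_truncation_le)
qed

lemma truncated_EM_measurable:
  fixes f :: "real^'d::finite \<Rightarrow> real^'d" and g :: "real^'d \<Rightarrow> real^'m::finite^'d"
  assumes f[measurable]: "f \<in> borel_measurable borel" and g[measurable]: "g \<in> borel_measurable borel"
    and sub: "\<And>s t. 0 \<le> s \<Longrightarrow> s \<le> t \<Longrightarrow> subalgebra (F t) (F s)"
    and B: "\<And>t. 0 \<le> t \<Longrightarrow> B t \<in> borel_measurable (F t)" and \<Delta>: "\<Delta> > 0"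
  shows "truncated_EM f g x0 B R \<Delta> k \<in> borel_measurable (F (real k * \<Delta>))"
proof (induction k)
  case 0
  have "truncated_EM f g x0 B R \<Delta> 0 = (\<lambda>_. x0)" by (rule ext) simp
  then show ?case by simp
next
  case (Suc k)
  have "real k * \<Delta> \<le> real (Suc k) * \<Delta>" "0 \<le> real k * \<Delta>" using \<Delta> by (auto intro: mult_right_mono)
  note s = sub[OF this(2,1)]
  have [measurable]: "truncated_EM f g x0 B R \<Delta> k \<in> borel_measurable (F (real (Suc k) * \<Delta>))"
    "B (real k * \<Delta>) \<in> borel_measurable (F (real (Suc k) * \<Delta>))"
    "B (real (Suc k) * \<Delta>) \<in> borel_measurable (F (real (Suc k) * \<Delta>))"
    using measurable_from_subalg[OF s Suc] measurable_from_subalg[OF s B] B[of "real (Suc k) * \<Delta>"] \<Delta>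
    by (simp_all del: of_nat_Suc)
  have [measurable]: "(\<lambda>\<omega>. g (truncated_EM f g x0 B R \<Delta> k \<omega>) *v (B (real (Suc k) * \<Delta>) \<omega> - B (real k * \<Delta>) \<omega>))
      \<in> borel_measurable (F (real (Suc k) * \<Delta>))"
    by (intro matrix_vector_mult_measurable) measurable
  have "truncated_EM f g x0 B R \<Delta> (Suc k) = (\<lambda>\<omega>. truncation R (truncated_EM f g x0 B R \<Delta> k \<omega>
      + \<Delta> *\<^sub>R f (truncated_EM f g x0 B R \<Delta> k \<omega>)
      + g (truncated_EM f g x0 B R \<Delta> k \<omega>) *v (B (real (Suc k) * \<Delta>) \<omega> - B (real k * \<Delta>) \<omega>)))"
    by (rule ext) (simp add: Let_def)
  then show ?case by (simp only:) measurable
qed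

lemma truncated_EM_dissipation:
  fixes f :: "real^'d::finite \<Rightarrow> real^'d" and g :: "real^'d \<Rightarrow> real^'m::finite^'d"
    and V w :: "real^'d \<Rightarrow> real"
  assumes space: "usual_filtered_space M F" and bm: "brownian_motion M F B"
    and f: "continuous_on UNIV f" and g: "continuous_on UNIV g"
    and V: "continuous_on UNIV V" "\<And>x. 0 \<le> V x" and w: "continuous_on UNIV w" "\<And>x. 0 \<le> w x"
    and \<Delta>: "\<Delta> > 0" and R: "R > 0" "norm x0 \<le> R" and \<epsilon>: "\<epsilon> > 0"
    and drift: "\<And>z. norm z \<le> R \<Longrightarrow>
      (\<integral>\<xi>. V (truncation R (z + \<Delta> *\<^sub>R f z + g z *v \<xi>)) \<partial>gauss (sqrt \<Delta>)) \<le> V z - \<epsilon> * w z"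
  shows "AE \<omega> in M. (\<lambda>k. w (truncated_EM f g x0 B R \<Delta> k \<omega>)) \<longlonglongrightarrow> 0"
proof -
  have "prob_space M"
    using space unfolding usual_filtered_space_def by (elim conjE)
  then interpret prob_space M .
  have sub_all: "\<forall>t\<ge>0. subalgebra M (F t)"
    using space unfolding usual_filtered_space_def by (elim conjE)
  have mono_all: "\<forall>s t. 0 \<le> s \<and> s \<le> t \<longrightarrow> sets (F s) \<subseteq> sets (F t)"
    using space unfolding usual_filtered_space_def by (elim conjE)
  let ?Z = "truncated_EM f g x0 B R \<Delta>"
  have subM: "subalgebra M (F t)" if "0 \<le> t" for t
    using sub_all that by blast
  have sub: "subalgebra (F t) (F s)" if "0 \<le> s" "s \<le> t" for s t
  proof -
    have "sets (F s) \<subseteq> sets (F t)" using mono_all that by blast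
    then show ?thesis using subM[of s] subM[of t] that by (auto simp: subalgebra_def)
  qed
  have [measurable]: "f \<in> borel_measurable borel" "g \<in> borel_measurable borel"
      "V \<in> borel_measurable borel" "w \<in> borel_measurable borel"
    using f g V w by (auto intro: borel_measurable_continuous_onI)
  have ZF: "?Z k \<in> borel_measurable (F (real k * \<Delta>))" for k
  proof (rule truncated_EM_measurable[OF _ _ sub _ \<Delta>])
    show "B t \<in> borel_measurable (F t)" if "0 \<le> t" for t
      using bm that unfolding brownian_motion_def by blast
  qed auto
  have Zm[measurable]: "?Z k \<in> borel_measurable M" for k
    using measurable_from_subalg[OF subM ZF[of k]] \<Delta> by simp
  have ZR: "norm (?Z k \<omega>) \<le> R" for k \<omega> by (rule norm_truncated_EM_le[OF R(2)])
  have int: "integrable M (\<lambda>\<omega>. u (?Z k \<omega>))" if u: "continuous_on UNIV u" for u :: "real^'d \<Rightarrow> real" and k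
  proof -
    have [measurable]: "u \<in> borel_measurable borel" using u by (rule borel_measurable_continuous_onI)
    obtain C where "\<And>x. dist 0 x \<le> R \<Longrightarrow> \<bar>u x\<bar> \<le> C"
      using continuous_bounded_on_ball[OF u, of 0 R] by blast
    then have "\<bar>u (?Z k \<omega>)\<bar> \<le> C" for \<omega> using ZR by simp
    then show ?thesis by (intro integrable_const_bound[of _ C]) auto
  qed
  obtain C where "\<And>x. dist 0 x \<le> R \<Longrightarrow> \<bar>V x\<bar> \<le> C"
    using continuous_bounded_on_ball[OF V(1), of 0 R] by blast
  then have C: "\<bar>V (truncation R x)\<bar> \<le> C" for x using norm_truncation_le[of R x] R by simp
  define H where "H z \<xi> = V (truncation R (z + \<Delta> *\<^sub>R f z + g z *v \<xi>))" for z and \<xi> :: "real^'m"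
  have [measurable]: "(\<lambda>p. g (fst p) *v snd p) \<in> borel_measurable (borel \<Otimes>\<^sub>M borel)"
    by (intro matrix_vector_mult_measurable) measurable
  have Hm: "(\<lambda>(z, \<xi>). H z \<xi>) \<in> borel_measurable (borel \<Otimes>\<^sub>M borel)"
    unfolding H_def split_beta by measurable
  \<comment> \<open>\<open>drift\<close> applies at every value of \<open>Z\<^sub>k\<close> because \<open>Z\<^sub>k\<close> never leaves the ball.\<close>
  have step: "expectation (\<lambda>\<omega>. V (?Z (Suc k) \<omega>)) \<le> expectation (\<lambda>\<omega>. V (?Z k \<omega>)) - \<epsilon> * expectation (\<lambda>\<omega>. w (?Z k \<omega>))" for k
  proof -
    define X where "X \<omega> = B (real (Suc k) * \<Delta>) \<omega> - B (real k * \<Delta>) \<omega>" for \<omega>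
    have t: "0 \<le> real k * \<Delta>" "real k * \<Delta> < real (Suc k) * \<Delta>" "real (Suc k) * \<Delta> - real k * \<Delta> = \<Delta>"
      using \<Delta> by (auto simp: algebra_simps)
    have incr: "indep_set (sets (vimage_algebra (space M) (\<lambda>\<omega>. B t \<omega> - B s \<omega>) borel)) (sets (F s)) \<and>
        distributed M lborel (\<lambda>\<omega>. B t \<omega> - B s \<omega>)
          (\<lambda>x. ennreal (\<Prod>i\<in>UNIV. normal_density 0 (sqrt (t - s)) (x $ i)))" if "0 \<le> s" "s < t" for s t
      using bm that unfolding brownian_motion_def by blast
    have X: "indep_set (sets (vimage_algebra (space M) X borel)) (sets (F (real k * \<Delta>)))"
      "distributed M lborel X (\<lambda>x. ennreal (\<Prod>i\<in>UNIV. normal_density 0 (sqrt \<Delta>) (x $ i)))"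
      using incr[OF t(1,2)] unfolding t(3) X_def[abs_def] by auto
    note E = expectation_independent_increment[OF subM[OF t(1)] ZF X Hm, of C]
    have "expectation (\<lambda>\<omega>. V (?Z (Suc k) \<omega>)) = expectation (\<lambda>\<omega>. H (?Z k \<omega>) (X \<omega>))"
      by (simp add: H_def X_def Let_def)
    also have "\<dots> = expectation (\<lambda>\<omega>. \<integral>\<xi>. H (?Z k \<omega>) \<xi> \<partial>gauss (sqrt \<Delta>))"
      by (rule E(1)) (simp add: H_def C)
    also have "\<dots> \<le> expectation (\<lambda>\<omega>. V (?Z k \<omega>) - \<epsilon> * w (?Z k \<omega>))"
    proof (rule integral_mono)
      have G: "(\<lambda>z. \<integral>\<xi>. H z \<xi> \<partial>gauss (sqrt \<Delta>)) \<in> borel_measurable borel"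
        by (rule E(2)) (simp add: H_def C)
      interpret G: prob_space "gauss (sqrt \<Delta>) :: (real^'m) measure"
        using \<Delta> by (intro prob_space_gauss) simp
      have Hi: "integrable (gauss (sqrt \<Delta>)) (H z)" for z
      proof (rule G.integrable_const_bound[of _ C])
        have "(\<lambda>\<xi>. H z \<xi>) \<in> borel_measurable borel"
          using measurable_compose[OF measurable_Pair1'[of z borel borel] Hm] by simp
        then show "H z \<in> borel_measurable (gauss (sqrt \<Delta>))" by simp
      qed (simp add: H_def C)
      have "\<bar>\<integral>\<xi>. H z \<xi> \<partial>gauss (sqrt \<Delta>)\<bar> \<le> C" for z
        using G.integral_ge_const[OF Hi, of "-C" z] G.integral_le_const[OF Hi, of z C] C
        by (auto simp: H_def abs_le_iff minus_le_iff)
      then show "integrable M (\<lambda>\<omega>. \<integral>\<xi>. H (?Z k \<omega>) \<xi> \<partial>gauss (sqrt \<Delta>))"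
        using measurable_compose[OF Zm G] by (intro integrable_const_bound[of _ C]) auto
    qed (use int V w drift ZR in \<open>auto simp: H_def\<close>)
    also have "\<dots> = expectation (\<lambda>\<omega>. V (?Z k \<omega>)) - \<epsilon> * expectation (\<lambda>\<omega>. w (?Z k \<omega>))"
      using int[OF V(1)] int[OF w(1)] by simp
    finally show ?thesis .
  qed
  show ?thesis
    by (rule AE_tendsto_0_of_decreasing_expectation[where v = "\<lambda>k. expectation (\<lambda>\<omega>. V (?Z k \<omega>))", OF int[OF w(1)] _ _ step \<epsilon>])
      (auto intro: w V Bochner_Integration.integral_nonneg)
qed

section \<open>Stability of the truncated Euler--Maruyama scheme\<close>

theorem theorem5p11:
  fixes f :: "real^'d::finite \<Rightarrow> real^'d"
    and g :: "real^'d \<Rightarrow> real^'m::finite^'d"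
    and x0 :: "real^'d"
    and M :: "'w measure" and F :: "real \<Rightarrow> 'w measure" and B :: "real \<Rightarrow> 'w \<Rightarrow> real^'m"
    and V w :: "real^'d \<Rightarrow> real"
    and \<phi> :: "real \<Rightarrow> real"
    and \<delta> \<theta> \<Delta>star K :: real
  assumes space: "usual_filtered_space M F"
    and bm: "brownian_motion M F B"
    and f_lip: "local_lipschitz (UNIV :: real set) UNIV (\<lambda>_. f)"
    and g_lip: "local_lipschitz (UNIV :: real set) UNIV (\<lambda>_. g)"
    and f0: "f 0 = 0" and g0: "g 0 = 0"
    and delta: "1 / \<delta> \<in> \<int>" "1 / \<delta> \<ge> 4"
    and V: "V \<in> lyapunov_class 4 \<delta>"
    and w: "continuous_on UNIV w" "\<forall>x. w x \<ge> 0"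
    and LV: "\<forall>x. generator f g V x \<le> - w x"
    and V_scale: "\<forall>x \<epsilon>. 0 < \<epsilon> \<and> \<epsilon> \<le> 1 \<longrightarrow> V (\<epsilon> *\<^sub>R x) \<le> V x"
    and fg_bound: "\<forall>u>0.
      (SUP x\<in>{x. 0 < norm x \<and> norm x \<le> u}.
         ennreal ((1 + V x) powr (1 - 2 * \<delta>) * max ((norm (f x))\<^sup>2) ((norm (g x))\<^sup>2))
           / ennreal (Lambda1 V w x * V x)) < \<infinity>"
    and phi: "strict_mono_on {0..} \<phi>" "continuous_on {0..} \<phi>" "\<forall>u\<ge>0. \<phi> u \<ge> 0"
      "filterlim \<phi> at_top at_top"
    and phi_bound: "\<forall>u\<ge>1.
      (SUP x\<in>{x. 0 < norm x \<and> norm x \<le> u}.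
         max (ennreal ((1 + V x) powr (1/2 - \<delta>) * norm (f x)) / ennreal (sqrt (Lambda1 V w x * V x)))
             (ennreal ((1 + V x) powr (1 - 2 * \<delta>) * (norm (g x))\<^sup>2) / ennreal (Lambda1 V w x * V x)))
        \<le> ennreal (\<phi> u)"
    and theta: "0 < \<theta>" "\<theta> < 1/2"
    and Dstar: "0 < \<Delta>star" "\<Delta>star < 1"
    and K: "K > 0" "K * \<Delta>star powr (- \<theta>) \<ge> \<phi> (max (norm x0) 1)"
  shows "\<exists>\<Delta>2. 0 < \<Delta>2 \<and> \<Delta>2 \<le> \<Delta>star \<and>
    (\<forall>\<Delta>. 0 < \<Delta> \<and> \<Delta> \<le> \<Delta>2 \<longrightarrow>
       (let Z = truncated_EM f g x0 B (trunc_radius \<phi> K \<theta> \<Delta>) \<Delta> in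
         (AE \<omega> in M.
            limsup (\<lambda>k. ereal (V (Z k \<omega>))) < \<infinity> \<and>
            (\<lambda>k. infdist (Z k \<omega>) {x. w x = 0}) \<longlonglongrightarrow> 0) \<and>
         ((\<forall>x. w x = 0 \<longleftrightarrow> x = 0) \<longrightarrow>
            (AE \<omega> in M. (\<lambda>k. Z k \<omega>) \<longlonglongrightarrow> 0))))"
proof -
  obtain n :: nat where n: "4 \<le> n" "\<delta> = 1 / real n"
  proof -
    obtain i where i: "1 / \<delta> = of_int i" using delta(1) by (auto elim: Ints_cases)
    then have "4 \<le> i" using delta(2) by simp
    moreover have "\<delta> = 1 / real (nat i)"
      using i \<open>4 \<le> i\<close> by (metis div_by_1 divide_divide_eq_right mult_1 of_nat_nat order_trans zero_le_numeral of_int_of_nat_eq)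
    ultimately show ?thesis using that[of "nat i"] by simp
  qed
  obtain c where c: "derivs_bounded n c V"
    using derivs_bounded_lyapunov V n by blast
  have Vnn: "0 \<le> V x" and Vpos: "x \<noteq> 0 \<Longrightarrow> 0 < V x" for x
    using V unfolding lyapunov_class_def by (auto simp: less_le)
  have Vcont: "continuous_on UNIV V"
    using c cont_diff_imp_continuous unfolding derivs_bounded_def by blast
  have fcont: "continuous_on UNIV f" and gcont: "continuous_on UNIV g"
    using local_lipschitz_continuous_on[OF f_lip] local_lipschitz_continuous_on[OF g_lip] by auto
  define C where "C = \<bar>taylor_const CARD('d) n c * gauss_const CARD('m) n\<bar> + 1"
  have C: "C > 0" "taylor_const CARD('d) n c * gauss_const CARD('m) n \<le> C" by (auto simp: C_def)
  \<comment> \<open>The last two bounds ensure \<open>\<Delta> * \<phi> R \<le> 1\<close> and \<open>C * (\<Delta> * \<phi> R)\<^sup>2 \<le> \<Delta> / 2\<close>, as \<open>\<phi> R = K * \<Delta> powr (- \<theta>)\<close>.\<close>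
  define \<Delta>2 where "\<Delta>2 = min \<Delta>star (min ((1 / K) powr (1 / (1 - \<theta>))) ((1 / (2 * C * K\<^sup>2)) powr (1 / (1 - 2 * \<theta>))))"
  have \<Delta>2: "0 < \<Delta>2" "\<Delta>2 \<le> \<Delta>star" using Dstar K C by (auto simp: \<Delta>2_def)
  have main: "(AE \<omega> in M. limsup (\<lambda>k. ereal (V (Z k \<omega>))) < \<infinity> \<and> (\<lambda>k. infdist (Z k \<omega>) {x. w x = 0}) \<longlonglongrightarrow> 0)"
    if \<Delta>: "0 < \<Delta>" "\<Delta> \<le> \<Delta>2" and Z: "Z = truncated_EM f g x0 B (trunc_radius \<phi> K \<theta> \<Delta>) \<Delta>" for \<Delta> Z
  proof -
    define P where "P = K * \<Delta> powr (- \<theta>)"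
    have P0: "0 \<le> P" using K by (simp add: P_def)
    have step1: "\<Delta> * P \<le> 1"
    proof -
      have "\<Delta> powr (1 - \<theta>) \<le> 1 / K"
        using \<Delta> K theta by (intro small_step_powr) (auto simp: \<Delta>2_def)
      moreover have "\<Delta> * P = K * \<Delta> powr (1 - \<theta>)"
        using \<Delta> by (simp add: P_def powr_diff powr_minus_divide)
      ultimately show ?thesis using K by (simp add: field_simps)
    qed
    have step2: "C * (\<Delta> * P)\<^sup>2 \<le> \<Delta> / 2"
    proof -
      have "\<Delta> powr (1 - 2 * \<theta>) \<le> 1 / (2 * C * K\<^sup>2)"
        using \<Delta> K C theta by (intro small_step_powr) (auto simp: \<Delta>2_def)
      then have "C * K\<^sup>2 * \<Delta> powr (1 - 2 * \<theta>) \<le> 1 / 2"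
        using K C by (simp add: field_simps)
      then have "\<Delta> * (C * K\<^sup>2 * \<Delta> powr (1 - 2 * \<theta>)) \<le> \<Delta> * (1 / 2)"
        using \<Delta> by (intro mult_left_mono) auto
      moreover have "\<Delta> powr (1 - 2 * \<theta>) = \<Delta> * (\<Delta> powr (- \<theta>))\<^sup>2"
        using \<Delta> by (simp add: power2_eq_square powr_add[symmetric] powr_mult_base)
      ultimately show ?thesis by (simp add: P_def power2_eq_square mult_ac)
    qed
    obtain R where R: "max (norm x0) 1 \<le> R" "\<phi> R = P"
    proof -
      have "\<Delta>star powr (- \<theta>) \<le> \<Delta> powr (- \<theta>)"
        using \<Delta> \<Delta>2 theta by (intro powr_mono2') auto
      then have "K * \<Delta>star powr (- \<theta>) \<le> P"
        unfolding P_def using K(1) by (intro mult_left_mono) auto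
      then have "\<phi> (max (norm x0) 1) \<le> P" using K(2) by linarith
      moreover obtain u where "max (norm x0) 1 \<le> u" "P \<le> \<phi> u"
      proof -
        have "\<forall>\<^sub>F u in at_top. P \<le> \<phi> u \<and> max (norm x0) 1 \<le> u"
          using phi(4) unfolding filterlim_at_top by (intro eventually_conj eventually_ge_at_top) blast
        then show ?thesis using that eventually_happens[of _ "at_top :: real filter"] by auto
      qed
      moreover have "continuous_on {max (norm x0) 1..u} \<phi>"
        by (rule continuous_on_subset[OF phi(2)]) auto
      ultimately show ?thesis using that IVT'[of \<phi> "max (norm x0) 1" P u] by blast
    qed
    have radius: "trunc_radius \<phi> K \<theta> \<Delta> = R"
      unfolding trunc_radius_def P_def[symmetric] R(2)[symmetric]
      using R(1) strict_mono_on_imp_inj_on[OF phi(1)] by (intro the_inv_into_f_f) auto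
    have Zeq: "Z = truncated_EM f g x0 B R \<Delta>" using Z radius by simp
    have drift: "(\<integral>\<xi>. V (truncation R (z + \<Delta> *\<^sub>R f z + g z *v \<xi>)) \<partial>gauss (sqrt \<Delta>)) \<le> V z - \<Delta> / 2 * w z"
      if z: "norm z \<le> R" for z
    proof -
      define m where "m = min (V z) (w z)"
      have m: "0 \<le> m" "m \<le> V z" "m \<le> w z" using Vnn[of z] w(2) by (auto simp: m_def)
      have fg: "(1 + V z) powr (1/2 - 1 / real n) * norm (f z) \<le> P * sqrt m \<and>
          (1 + V z) powr (1 - 2 * (1 / real n)) * (norm (g z))\<^sup>2 \<le> P * m"
      proof (cases "z = 0")
        case True
        then show ?thesis using f0 g0 P0 m by simp
      next
        case False
        have \<Lambda>: "Lambda1 V w z * V z = m"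
          using Vpos[OF False] by (auto simp: Lambda1_def m_def min_def field_simps)
        have "max (ennreal ((1 + V z) powr (1/2 - \<delta>) * norm (f z)) / ennreal (sqrt (Lambda1 V w z * V z)))
             (ennreal ((1 + V z) powr (1 - 2 * \<delta>) * (norm (g z))\<^sup>2) / ennreal (Lambda1 V w z * V z)) \<le> ennreal (\<phi> R)"
          using phi_bound[rule_format, of R] R(1) z False by (auto simp: SUP_le_iff)
        then show ?thesis
          unfolding \<Lambda> R(2) n(2) max.bounded_iff using P0 m
          by (auto intro!: le_of_ennreal_divide_le)
      qed
      have "(\<integral>\<xi>. V (truncation R (z + \<Delta> *\<^sub>R f z + g z *v \<xi>)) \<partial>gauss (sqrt \<Delta>))
        \<le> V z + \<Delta> * generator f g V z + taylor_const CARD('d) n c * gauss_const CARD('m) n * ((\<Delta> * P)\<^sup>2 * m)"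
        using V_scale R(1) \<Delta> P0 step1 m fg by (intro one_step_drift[OF c]) auto
      also have "taylor_const CARD('d) n c * gauss_const CARD('m) n * ((\<Delta> * P)\<^sup>2 * m) \<le> C * ((\<Delta> * P)\<^sup>2 * m)"
        using C m by (intro mult_right_mono) auto
      also have "C * ((\<Delta> * P)\<^sup>2 * m) = C * (\<Delta> * P)\<^sup>2 * m" by simp
      also have "\<dots> \<le> \<Delta> / 2 * w z" using step2 m \<Delta> by (intro mult_mono) auto
      also have "\<Delta> * generator f g V z \<le> \<Delta> * (- w z)" using LV \<Delta> by (intro mult_left_mono) auto
      finally show ?thesis by simp
    qed
    have R0: "R > 0" "norm x0 \<le> R" using R(1) by auto
    have bounded: "norm (Z k \<omega>) \<le> R" for k \<omega>
      unfolding Zeq by (rule norm_truncated_EM_le[OF R0(2)])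
    have "AE \<omega> in M. (\<lambda>k. w (Z k \<omega>)) \<longlonglongrightarrow> 0"
      unfolding Zeq using w Vnn \<Delta>
      by (intro truncated_EM_dissipation[OF space bm fcont gcont Vcont _ _ _ _ R0 _ drift]) auto
    then show ?thesis
    proof eventually_elim
      case (elim \<omega>)
      have "(\<lambda>k. infdist (Z k \<omega>) {x. w x = 0}) \<longlonglongrightarrow> 0"
        using w elim bounded by (intro tendsto_infdist_zero_set) (auto simp: bounded_iff)
      moreover have "limsup (\<lambda>k. ereal (V (Z k \<omega>))) < \<infinity>"
      proof -
        obtain A where "\<And>x. dist 0 x \<le> R \<Longrightarrow> \<bar>V x\<bar> \<le> A"
          using continuous_bounded_on_ball[OF Vcont, of 0 R] by blast
        then have "V (Z k \<omega>) \<le> A" for k using bounded[of k \<omega>] by (auto simp: abs_le_iff)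
        then have "limsup (\<lambda>k. ereal (V (Z k \<omega>))) \<le> ereal A"
          by (intro Limsup_bounded always_eventually) auto
        then show ?thesis by (rule le_less_trans) simp
      qed
      ultimately show ?case by simp
    qed
  qed
  show ?thesis
  proof (intro exI[of _ \<Delta>2] conjI allI impI \<Delta>2)
    fix \<Delta> assume "0 < \<Delta> \<and> \<Delta> \<le> \<Delta>2"
    note * = main[OF conjunct1[OF this] conjunct2[OF this] refl]
    show "let Z = truncated_EM f g x0 B (trunc_radius \<phi> K \<theta> \<Delta>) \<Delta> in
         (AE \<omega> in M.
            limsup (\<lambda>k. ereal (V (Z k \<omega>))) < \<infinity> \<and>
            (\<lambda>k. infdist (Z k \<omega>) {x. w x = 0}) \<longlonglongrightarrow> 0) \<and>
         ((\<forall>x. w x = 0 \<longleftrightarrow> x = 0) \<longrightarrow>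
            (AE \<omega> in M. (\<lambda>k. Z k \<omega>) \<longlonglongrightarrow> 0))"
      unfolding Let_def
    proof (intro conjI impI *)
      assume "\<forall>x. w x = 0 \<longleftrightarrow> x = 0"
      then have "{x. w x = 0} = {0}" by auto
      with * show "AE \<omega> in M. (\<lambda>k. truncated_EM f g x0 B (trunc_radius \<phi> K \<theta> \<Delta>) \<Delta> k \<omega>) \<longlonglongrightarrow> 0"
        by (auto simp: tendsto_norm_zero_iff elim!: eventually_mono)
    qed
  qed
qed

end
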